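(* Fix $\theta\in(0,\pi/4]$ and a W-class resource $|W\rangle_{A'B'K}=\alpha|001\rangle+\beta|010\rangle+\gamma|100\rangle$ with real $\alpha,\beta,\gamma>0$, $\alpha^2+\beta^2+\gamma^2=1$, in addition to the link $|\psi(\theta)\rangle_{AB}=\cos\theta|00\rangle+\sin\theta|11\rangle$. In the transfer model, Alice and Bob can deterministically restore a Bell pair on $AB$ by LOCC if and only if $$\frac{1-\tan^2\theta}{2}\le\beta^2\le\frac{1+\tan^2\theta}{2}.$$
   Context: All registers $A,B,A',B',K$ are qubits; in $|W\rangle_{A'B'K}$ the tensor factors are ordered $A',B',K$. The global initial state is $|\psi(\theta)\rangle_{AB}\otimes|W\rangle_{A'B'K}$. Initially Alice holds $A,A'$; Bob holds $B,B'$; the Bank holds $K$. LOCC means local quantum operations by Alice and Bob (local ancillas and discarding of systems allowed) with finitely many rounds of classical communication between them. Transfer model: the Bank hands $K$ to Alice and is then absent; Alice (holding $AA'K$) and Bob (holding $BB'$) act by LOCC. Deterministic restoration of a Bell pair on $AB$ means that, with probability one, the final state of the registers $A$ and $B$ is exactly $|\Phi^+\rangle=\frac{1}{\sqrt2}(|00\rangle+|11\rangle)$; other registers may be left in any state or discarded. *)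

theory Defs
  imports Complex_Main "Jordan_Normal_Form.Schur_Decomposition"
begin

text \<open>
  Composite systems use the lexicographic basis: the pair \<open>(i, j)\<close> of basis labels, with
  \<open>j < n\<close>, is the index \<open>i * n + j\<close>, so the leftmost tensor factor is the most significant one.
\<close>

definition tensor_vec :: "complex vec \<Rightarrow> complex vec \<Rightarrow> complex vec" where
  "tensor_vec u v =
     vec (dim_vec u * dim_vec v) (\<lambda>i. u $ (i div dim_vec v) * v $ (i mod dim_vec v))"

definition tensor_mat :: "complex mat \<Rightarrow> complex mat \<Rightarrow> complex mat" where
  "tensor_mat M N =
     mat (dim_row M * dim_row N) (dim_col M * dim_col N)
       (\<lambda>(i, j). M $$ (i div dim_row N, j div dim_col N) * N $$ (i mod dim_row N, j mod dim_col N))"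

definition sum_mats :: "nat \<Rightarrow> complex mat list \<Rightarrow> complex mat" where
  "sum_mats n Ms = foldr (+) Ms (0\<^sub>m n n)"

definition mat_trace :: "complex mat \<Rightarrow> complex" where
  "mat_trace M = (\<Sum>i<dim_row M. M $$ (i, i))"

definition proj_on :: "complex vec \<Rightarrow> complex mat" where
  "proj_on v = mat (dim_vec v) (dim_vec v) (\<lambda>(i, j). v $ i * cnj (v $ j))"

definition bits_val :: "nat list \<Rightarrow> nat" where
  "bits_val bs = foldl (\<lambda>n b. 2 * n + b) 0 bs"

definition ket :: "nat list \<Rightarrow> complex vec" where
  "ket bs = unit_vec (2 ^ length bs) (bits_val bs)"

definition Phi_plus :: "complex vec" where
  "Phi_plus = complex_of_real (1 / sqrt 2) \<cdot>\<^sub>v (ket [0,0] + ket [1,1])"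

definition link_state :: "real \<Rightarrow> complex vec" where
  "link_state \<theta> =
     complex_of_real (cos \<theta>) \<cdot>\<^sub>v ket [0,0] + complex_of_real (sin \<theta>) \<cdot>\<^sub>v ket [1,1]"

definition W_state :: "real \<Rightarrow> real \<Rightarrow> real \<Rightarrow> complex vec" where
  "W_state \<alpha> \<beta> \<gamma> =
     complex_of_real \<alpha> \<cdot>\<^sub>v ket [0,0,1] + complex_of_real \<beta> \<cdot>\<^sub>v ket [0,1,0]
     + complex_of_real \<gamma> \<cdot>\<^sub>v ket [1,0,0]"

text \<open>Register order \<open>A, B, A', B', K\<close>.\<close>

definition global_state :: "real \<Rightarrow> real \<Rightarrow> real \<Rightarrow> real \<Rightarrow> complex vec" where
  "global_state \<theta> \<alpha> \<beta> \<gamma> = tensor_vec (link_state \<theta>) (W_state \<alpha> \<beta> \<gamma>)"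

text \<open>
  The transfer model: once \<open>K\<close> has been handed over, Alice holds \<open>A, A', K\<close> (dimension 8) and
  Bob holds \<open>B, B'\<close> (dimension 4). The same state vector is regrouped from the register order
  \<open>A, B, A', B', K\<close> to the order \<open>A, A', K, B, B'\<close>.
\<close>

definition transfer_state :: "real \<Rightarrow> real \<Rightarrow> real \<Rightarrow> real \<Rightarrow> complex vec" where
  "transfer_state \<theta> \<alpha> \<beta> \<gamma> =
     vec (8 * 4) (\<lambda>i.
       let a = i div 16 mod 2; a' = i div 8 mod 2; k = i div 4 mod 2;
           b = i div 2 mod 2; b' = i mod 2
       in global_state \<theta> \<alpha> \<beta> \<gamma> $ bits_val [a, b, a', b', k])"

text \<open>
  A local operation is a quantum instrument with finitely many outcomes. An outcome is given by
  the dimension \<open>d\<close> of the system that the acting party holds afterwards and by a list of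
  Kraus operators from dimension \<open>n\<close> to dimension \<open>d\<close>. The operators are rectangular, so
  appending ancillas (isometries) and discarding subsystems (partial traces) are instruments.
\<close>

definition instrument :: "nat \<Rightarrow> (nat \<times> complex mat list) list \<Rightarrow> bool" where
  "instrument n es \<longleftrightarrow>
     (\<forall>(d, Ks) \<in> set es. 0 < d \<and> set Ks \<subseteq> carrier_mat d n) \<and>
     sum_mats n [mat_adjoint K * K. (d, Ks) \<leftarrow> es, K \<leftarrow> Ks] = 1\<^sub>m n"

text \<open>
  A protocol is a tree of finite depth. At each node one party applies an instrument and announces
  the outcome, and the continuation of both parties depends on all outcomes announced so far.
\<close>

datatype protocol =
    Stop
  | Alice_acts "(nat \<times> complex mat list \<times> protocol) list"
  | Bob_acts "(nat \<times> complex mat list \<times> protocol) list"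

inductive locc :: "nat \<Rightarrow> nat \<Rightarrow> protocol \<Rightarrow> bool" where
  "locc dA dB Stop"
| "\<lbrakk>instrument dA (map (\<lambda>(d, Ks, P). (d, Ks)) bs);
    \<forall>(d, Ks, P) \<in> set bs. locc d dB P\<rbrakk>
   \<Longrightarrow> locc dA dB (Alice_acts bs)"
| "\<lbrakk>instrument dB (map (\<lambda>(d, Ks, P). (d, Ks)) bs);
    \<forall>(d, Ks, P) \<in> set bs. locc dA d P\<rbrakk>
   \<Longrightarrow> locc dA dB (Bob_acts bs)"

definition apply_kraus :: "nat \<Rightarrow> complex mat list \<Rightarrow> complex mat \<Rightarrow> complex mat" where
  "apply_kraus d Ks \<rho> = sum_mats d [K * \<rho> * mat_adjoint K. K \<leftarrow> Ks]"

text \<open>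
  \<open>final_branch P dA dB \<rho> dA' dB' \<sigma>\<close>: some sequence of outcomes of \<open>P\<close>, started in \<open>\<rho>\<close> on local
  dimensions \<open>dA, dB\<close>, ends in the unnormalised state \<open>\<sigma>\<close> on local dimensions \<open>dA', dB'\<close>. The trace
  of \<open>\<sigma>\<close> is the probability of that sequence of outcomes (for a density operator \<open>\<rho>\<close>).
\<close>

inductive final_branch ::
  "protocol \<Rightarrow> nat \<Rightarrow> nat \<Rightarrow> complex mat \<Rightarrow> nat \<Rightarrow> nat \<Rightarrow> complex mat \<Rightarrow> bool" where
  "final_branch Stop dA dB \<rho> dA dB \<rho>"
| "\<lbrakk>(d, Ks, P) \<in> set bs;
    final_branch P d dB (apply_kraus (d * dB) (map (\<lambda>K. tensor_mat K (1\<^sub>m dB)) Ks) \<rho>) dA' dB' \<sigma>\<rbrakk>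
   \<Longrightarrow> final_branch (Alice_acts bs) dA dB \<rho> dA' dB' \<sigma>"
| "\<lbrakk>(d, Ks, P) \<in> set bs;
    final_branch P dA d (apply_kraus (dA * d) (map (\<lambda>K. tensor_mat (1\<^sub>m dA) K) Ks) \<rho>) dA' dB' \<sigma>\<rbrakk>
   \<Longrightarrow> final_branch (Bob_acts bs) dA dB \<rho> dA' dB' \<sigma>"

text \<open>
  Partial trace over everything but the qubits \<open>A\<close> and \<open>B\<close>, where Alice holds \<open>A\<close> and a system of
  dimension \<open>rA\<close> and Bob holds \<open>B\<close> and a system of dimension \<open>rB\<close>, in this tensor order.
\<close>

definition reduced_AB :: "nat \<Rightarrow> nat \<Rightarrow> complex mat \<Rightarrow> complex mat" where
  "reduced_AB rA rB \<sigma> =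
     mat 4 4 (\<lambda>(i, j).
       \<Sum>x<rA. \<Sum>y<rB.
         \<sigma> $$ (((i div 2) * rA + x) * (2 * rB) + ((i mod 2) * rB + y),
                ((j div 2) * rA + x) * (2 * rB) + ((j mod 2) * rB + y)))"

definition Bell_pair_on_AB :: "nat \<Rightarrow> nat \<Rightarrow> complex mat \<Rightarrow> bool" where
  "Bell_pair_on_AB dA dB \<sigma> \<longleftrightarrow>
     (\<exists>rA rB. dA = 2 * rA \<and> dB = 2 * rB \<and>
        (1 / mat_trace \<sigma>) \<cdot>\<^sub>m reduced_AB rA rB \<sigma> = proj_on Phi_plus)"

definition restores_Bell_pair :: "protocol \<Rightarrow> nat \<Rightarrow> nat \<Rightarrow> complex mat \<Rightarrow> bool" where
  "restores_Bell_pair P dA dB \<rho> \<longleftrightarrow>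
     (\<forall>dA' dB' \<sigma>. final_branch P dA dB \<rho> dA' dB' \<sigma> \<and> mat_trace \<sigma> \<noteq> 0
        \<longrightarrow> Bell_pair_on_AB dA' dB' \<sigma>)"

definition transfer_restorable :: "real \<Rightarrow> real \<Rightarrow> real \<Rightarrow> real \<Rightarrow> bool" where
  "transfer_restorable \<theta> \<alpha> \<beta> \<gamma> \<longleftrightarrow>
     (\<exists>P. locc 8 4 P \<and> restores_Bell_pair P 8 4 (proj_on (transfer_state \<theta> \<alpha> \<beta> \<gamma>)))"

end

theory Submission
  imports Defs "HOL-Analysis.L2_Norm"
begin

text \<open>
  Across the cut between Alice and Bob the initial state has squared Schmidt coefficients
  \<open>{cos\<^sup>2 \<theta>, sin\<^sup>2 \<theta>} \<cdot> {\<beta>\<^sup>2, 1 - \<beta>\<^sup>2}\<close>, and the stated interval says that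
  the largest one is at most \<open>1/2\<close>, as in Nielsen's majorisation criterion.

  Necessity: identify a pure bipartite state with its coefficient matrix. The largest squared Schmidt
  coefficient is the supremum of \<open>|X v|\<^sup>2 / |v|\<^sup>2\<close>, and by completeness of an instrument its average over the
  outcomes cannot be smaller than its value before the measurement. A Bell pair on \<open>AB\<close>, with anything
  else attached, has it at most half of the weight, so this bound travels backwards through the
  protocol.

  Sufficiency: if the four squared coefficients are at most \<open>1/2\<close>, they are the degrees of a nonnegative
  edge weighting \<open>q\<close> of the complete graph on the four Schmidt indices. Bob measures which pair
  \<open>{i, j}\<close>, with filters that leave the state maximally entangled on the pair, and Alice then decodes
  the pair to a qubit.
\<close>

section \<open>Coefficient matrices, index arithmetic and sums of matrices\<close>

definition sqnorm :: "complex vec \<Rightarrow> real" where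
  "sqnorm v = (\<Sum>i<dim_vec v. (cmod (v $ i))\<^sup>2)"

text \<open>The squared Frobenius norm. For a coefficient matrix this is the squared norm of the
  state, i.e. the weight of an unnormalised pure state.\<close>

definition frob :: "complex mat \<Rightarrow> real" where
  "frob X = (\<Sum>i<dim_row X. \<Sum>j<dim_col X. (cmod (X $$ (i, j)))\<^sup>2)"

text \<open>Rows are Alice's basis labels and columns are Bob's; the row-major order agrees with the
  lexicographic tensor basis.\<close>

definition flat :: "complex mat \<Rightarrow> complex vec" where
  "flat X = vec (dim_row X * dim_col X) (\<lambda>i. X $$ (i div dim_col X, i mod dim_col X))"

text \<open>Mixed states are handled as lists of unnormalised pure states, given by coefficient matrices.\<close>

definition ens :: "nat \<Rightarrow> complex mat list \<Rightarrow> complex mat" where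
  "ens n Xs = sum_mats n (map (\<lambda>X. proj_on (flat X)) Xs)"

lemma pair_index_less:
  fixes a b m n :: nat
  assumes "a < m" "b < n"
  shows "a * n + b < m * n"
proof -
  have "a * n + b < Suc a * n" using assms by simp
  also have "\<dots> \<le> m * n" using assms by (intro mult_right_mono) auto
  finally show ?thesis .
qed

lemma sum_pair_index:
  fixes f :: "nat \<Rightarrow> 'a::comm_monoid_add"
  shows "(\<Sum>i<m * n. f i) = (\<Sum>a<m. \<Sum>b<n. f (a * n + b))"
  by (simp add: sum.nat_group[symmetric] sum.shift_bounds_nat_ivl atLeast0LessThan
      sum.atLeastLessThan_shift_0 add.commute)

lemma mat_adjoint_dim [simp]:
  "dim_row (mat_adjoint K) = dim_col K" "dim_col (mat_adjoint K) = dim_row K"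
  by (auto simp: mat_adjoint_def)

lemma mat_adjoint_index:
  "i < dim_col K \<Longrightarrow> j < dim_row K \<Longrightarrow> mat_adjoint K $$ (i, j) = cnj (K $$ (j, i))"
  by (simp add: mat_adjoint_def mat_of_rows_def)

lemma sum_mats_Nil [simp]: "sum_mats n [] = 0\<^sub>m n n"
  by (simp add: sum_mats_def)

lemma sum_mats_Cons [simp]: "sum_mats n (M # Ms) = M + sum_mats n Ms"
  by (simp add: sum_mats_def)

lemma sum_mats_carrier [simp]: "sum_mats n Ms \<in> carrier_mat n n"
  by (induction Ms) auto

lemma sum_mats_index:
  "i < n \<Longrightarrow> j < n \<Longrightarrow> sum_mats n Ms $$ (i, j) = (\<Sum>M\<leftarrow>Ms. M $$ (i, j))"
proof (induction Ms)
  case (Cons M Ms)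
  have "dim_row (sum_mats n Ms) = n" "dim_col (sum_mats n Ms) = n"
    using sum_mats_carrier[of n Ms] by blast+
  with Cons show ?case by simp
qed simp

lemma sum_mats_append:
  assumes "set Ms \<subseteq> carrier_mat n n"
  shows "sum_mats n (Ms @ Ns) = sum_mats n Ms + sum_mats n Ns"
  using assms
proof (induction Ms)
  case Nil
  show ?case using left_add_zero_mat[OF sum_mats_carrier] by simp
next
  case (Cons M Ms)
  then show ?case by (simp add: assoc_add_mat[OF _ sum_mats_carrier sum_mats_carrier])
qed

lemma flat_carrier [simp]: "X \<in> carrier_mat a b \<Longrightarrow> flat X \<in> carrier_vec (a * b)"
  by (auto simp: flat_def)

lemma flat_index:
  assumes "X \<in> carrier_mat m n" "i < m" "j < n"
  shows "flat X $ (i * n + j) = X $$ (i, j)"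
  using assms pair_index_less[of i m j n] by (auto simp: flat_def)

section \<open>Local operations on ensembles of pure states\<close>

lemma proj_on_carrier [simp]: "v \<in> carrier_vec n \<Longrightarrow> proj_on v \<in> carrier_mat n n"
  by (auto simp: proj_on_def)

lemma proj_on_mult_mat_vec:
  assumes K: "K \<in> carrier_mat d n" and v: "v \<in> carrier_vec n"
  shows "K * proj_on v * mat_adjoint K = proj_on (K *\<^sub>v v)"
proof (rule eq_matI)
  fix i j assume "i < dim_row (proj_on (K *\<^sub>v v))" "j < dim_col (proj_on (K *\<^sub>v v))"
  then have ij: "i < d" "j < d" using K by (auto simp: proj_on_def)
  have dv: "dim_vec v = n" "dim_row K = d" "dim_col K = n" using K v by auto
  have 1: "(K * proj_on v) $$ (i, k) = (\<Sum>l<n. K $$ (i, l) * v $ l) * cnj (v $ k)"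
    if "k < n" for k
    using that ij dv by (simp add: scalar_prod_def proj_on_def atLeast0LessThan sum_distrib_left mult_ac)
  have "(K * proj_on v * mat_adjoint K) $$ (i, j)
      = (\<Sum>k<n. (K * proj_on v) $$ (i, k) * cnj (K $$ (j, k)))"
    using ij dv by (simp add: scalar_prod_def proj_on_def atLeast0LessThan mat_adjoint_index)
  also have "\<dots> = (\<Sum>k<n. (\<Sum>l<n. K $$ (i, l) * v $ l) * cnj (K $$ (j, k) * v $ k))"
    by (intro sum.cong) (auto simp: 1)
  also have "\<dots> = (\<Sum>l<n. K $$ (i, l) * v $ l) * cnj (\<Sum>l<n. K $$ (j, l) * v $ l)"
    by (simp add: sum_distrib_left)
  also have "\<dots> = proj_on (K *\<^sub>v v) $$ (i, j)"
    using ij dv by (simp add: scalar_prod_def proj_on_def atLeast0LessThan)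
  finally show "(K * proj_on v * mat_adjoint K) $$ (i, j) = proj_on (K *\<^sub>v v) $$ (i, j)" .
qed (use K in \<open>auto simp: proj_on_def\<close>)

lemma conj_sum_mats:
  assumes K: "K \<in> carrier_mat d n" and Ms: "set Ms \<subseteq> carrier_mat n n"
  shows "K * sum_mats n Ms * mat_adjoint K
    = sum_mats d (map (\<lambda>M. K * M * mat_adjoint K) Ms)"
  using Ms
proof (induction Ms)
  case Nil
  show ?case using K by simp
next
  case (Cons M Ms)
  then have M: "M \<in> carrier_mat n n" by simp
  have "K * (M + sum_mats n Ms) * mat_adjoint K
      = (K * M + K * sum_mats n Ms) * mat_adjoint K"
    by (simp add: mult_add_distrib_mat[OF K M sum_mats_carrier])
  also have "\<dots> = K * M * mat_adjoint K + K * sum_mats n Ms * mat_adjoint K"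
    using K M by (intro add_mult_distrib_mat[of _ d n]) (auto intro!: mult_carrier_mat[OF _ sum_mats_carrier])
  finally show ?case using Cons by simp
qed

text \<open>One argument serves both parties: \<open>T\<close> embeds a local Kraus operator into
  the whole system and \<open>F\<close> is its effect on a coefficient matrix. Each Kraus operator
  sends a pure term to a pure term, so an ensemble stays an ensemble, with one term for each pair of
  an operator and an old term.\<close>

lemma apply_kraus_ens:
  assumes Ts: "\<And>K. K \<in> set Ks \<Longrightarrow> T K \<in> carrier_mat d n"
    and Xs: "\<And>X. X \<in> set Xs \<Longrightarrow> flat X \<in> carrier_vec n"
    and T: "\<And>K X. K \<in> set Ks \<Longrightarrow> X \<in> set Xs \<Longrightarrow> T K *\<^sub>v flat X = flat (F K X)"
  shows "apply_kraus d (map T Ks) (ens n Xs) = ens d [F K X. K \<leftarrow> Ks, X \<leftarrow> Xs]"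
  using Ts T
proof (induction Ks)
  case Nil
  show ?case by (simp add: apply_kraus_def ens_def)
next
  case (Cons K Ks)
  have K: "T K \<in> carrier_mat d n" using Cons.prems by simp
  have 1: "T K * ens n Xs * mat_adjoint (T K) = ens d (map (F K) Xs)"
  proof -
    have "T K * ens n Xs * mat_adjoint (T K)
        = sum_mats d (map (\<lambda>M. T K * M * mat_adjoint (T K)) (map (\<lambda>X. proj_on (flat X)) Xs))"
      unfolding ens_def by (rule conj_sum_mats[OF K]) (use Xs in auto)
    also have "map (\<lambda>M. T K * M * mat_adjoint (T K)) (map (\<lambda>X. proj_on (flat X)) Xs)
        = map (\<lambda>X. proj_on (flat X)) (map (F K) Xs)"
      using proj_on_mult_mat_vec[OF K Xs] Cons.prems(2) by simp
    finally show ?thesis by (simp add: ens_def)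
  qed
  have 2: "proj_on (flat (F K X)) \<in> carrier_mat d d" if "X \<in> set Xs" for X
    using Cons.prems(2)[of K X] K Xs[OF that] that
    by (intro proj_on_carrier) (metis list.set_intros(1) mult_mat_vec_carrier)
  have IH: "apply_kraus d (map T Ks) (ens n Xs) = ens d [F K X. K \<leftarrow> Ks, X \<leftarrow> Xs]"
    using Cons by simp
  have "apply_kraus d (map T (K # Ks)) (ens n Xs)
     = ens d (map (F K) Xs) + apply_kraus d (map T Ks) (ens n Xs)"
    by (simp add: apply_kraus_def 1)
  also have "\<dots> = ens d (map (F K) Xs @ [F K X. K \<leftarrow> Ks, X \<leftarrow> Xs])"
    unfolding IH unfolding ens_def map_append by (rule sum_mats_append[symmetric]) (use 2 in auto)
  finally show ?case by simp
qed

lemma tensor_mat_carrier: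
  "M \<in> carrier_mat a b \<Longrightarrow> N \<in> carrier_mat c d \<Longrightarrow> tensor_mat M N \<in> carrier_mat (a * c) (b * d)"
  by (auto simp: tensor_mat_def)

text \<open>The vectorisation identity: an operator on Alice's factor acts on the row index, that
  is, by multiplication from the left.\<close>

lemma tensor_mat_flat_left:
  assumes K: "K \<in> carrier_mat d m" and X: "X \<in> carrier_mat m n"
  shows "tensor_mat K (1\<^sub>m n) *\<^sub>v flat X = flat (K * X)"
proof (rule eq_vecI)
  show "dim_vec (tensor_mat K (1\<^sub>m n) *\<^sub>v flat X) = dim_vec (flat (K * X))"
    using K X by (simp add: tensor_mat_def flat_def)
  fix i assume "i < dim_vec (flat (K * X))"
  then have i: "i < d * n" using K X by (simp add: flat_def)
  then have n: "n > 0" by (cases n) auto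
  have i': "i div n < d" "i mod n < n" using i n by (auto simp: less_mult_imp_div_less)
  have "(tensor_mat K (1\<^sub>m n) *\<^sub>v flat X) $ i
      = (\<Sum>j<m * n. tensor_mat K (1\<^sub>m n) $$ (i, j) * flat X $ j)"
    using K X i by (simp add: scalar_prod_def atLeast0LessThan tensor_mat_def flat_def)
  also have "\<dots> = (\<Sum>a<m. \<Sum>b<n. K $$ (i div n, a) * (if i mod n = b then 1 else 0) * X $$ (a, b))"
    unfolding sum_pair_index using K X i i' n
    by (intro sum.cong refl) (auto simp: tensor_mat_def flat_index[OF X] pair_index_less)
  also have "\<dots> = (\<Sum>a<m. K $$ (i div n, a) * X $$ (a, i mod n))"
    using i' by (intro sum.cong refl) (simp add: if_distrib if_distribR sum.delta cong: if_cong)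
  also have "\<dots> = flat (K * X) $ i"
    using K X i i' by (simp add: flat_def scalar_prod_def atLeast0LessThan)
  finally show "(tensor_mat K (1\<^sub>m n) *\<^sub>v flat X) $ i = flat (K * X) $ i" .
qed

text \<open>Bob's operator acts on the column index, which is multiplication by the transpose from
  the right. There is no conjugation, because \<open>flat\<close> is linear.\<close>

lemma tensor_mat_flat_right:
  assumes K: "K \<in> carrier_mat d n" and X: "X \<in> carrier_mat m n"
  shows "tensor_mat (1\<^sub>m m) K *\<^sub>v flat X = flat (X * transpose_mat K)"
proof (rule eq_vecI)
  show "dim_vec (tensor_mat (1\<^sub>m m) K *\<^sub>v flat X) = dim_vec (flat (X * transpose_mat K))"
    using K X by (simp add: tensor_mat_def flat_def)
  fix i assume "i < dim_vec (flat (X * transpose_mat K))"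
  then have i: "i < m * d" using K X by (simp add: flat_def)
  then have d: "d > 0" by (cases d) auto
  have i': "i div d < m" "i mod d < d" using i d by (auto simp: less_mult_imp_div_less)
  have "(tensor_mat (1\<^sub>m m) K *\<^sub>v flat X) $ i
      = (\<Sum>j<m * n. tensor_mat (1\<^sub>m m) K $$ (i, j) * flat X $ j)"
    using K X i by (simp add: scalar_prod_def atLeast0LessThan tensor_mat_def flat_def)
  also have "\<dots> = (\<Sum>a<m. \<Sum>b<n. (if i div d = a then 1 else 0) * K $$ (i mod d, b) * X $$ (a, b))"
    unfolding sum_pair_index using K X i i' d
    by (intro sum.cong refl) (auto simp: tensor_mat_def flat_index[OF X] pair_index_less)
  also have "\<dots> = (\<Sum>a<m. if i div d = a then (\<Sum>b<n. K $$ (i mod d, b) * X $$ (a, b)) else 0)"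
    by (intro sum.cong refl) auto
  also have "\<dots> = (\<Sum>b<n. K $$ (i mod d, b) * X $$ (i div d, b))"
    using i' by (simp add: sum.delta)
  also have "\<dots> = flat (X * transpose_mat K) $ i"
    using K X i i' by (simp add: flat_def scalar_prod_def atLeast0LessThan mult.commute)
  finally show "(tensor_mat (1\<^sub>m m) K *\<^sub>v flat X) $ i = flat (X * transpose_mat K) $ i" .
qed

lemma sum_list_of_real:
  fixes f :: "'a \<Rightarrow> real"
  shows "(\<Sum>x\<leftarrow>xs. complex_of_real (f x)) = complex_of_real (\<Sum>x\<leftarrow>xs. f x)"
  by (induction xs) auto

lemma sum_list_sum_swap:
  fixes f :: "'a \<Rightarrow> 'b \<Rightarrow> 'c::comm_monoid_add"
  shows "(\<Sum>x\<leftarrow>xs. \<Sum>j\<in>A. f x j) = (\<Sum>j\<in>A. \<Sum>x\<leftarrow>xs. f x j)"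
  by (induction xs) (auto simp: sum.distrib)

lemma ens_index:
  assumes "set Xs \<subseteq> carrier_mat m n" "a < m" "b < n" "a' < m" "b' < n"
  shows "ens (m * n) Xs $$ (a * n + b, a' * n + b') = (\<Sum>X\<leftarrow>Xs. X $$ (a, b) * cnj (X $$ (a', b')))"
proof -
  have "ens (m * n) Xs $$ (a * n + b, a' * n + b')
     = (\<Sum>X\<leftarrow>Xs. proj_on (flat X) $$ (a * n + b, a' * n + b'))"
    using assms by (simp add: ens_def sum_mats_index pair_index_less o_def)
  also have "\<dots> = (\<Sum>X\<leftarrow>Xs. X $$ (a, b) * cnj (X $$ (a', b')))"
  proof (rule arg_cong[where f = sum_list], rule map_cong[OF refl])
    fix X assume "X \<in> set Xs"
    then have X: "X \<in> carrier_mat m n" using assms by auto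
    then show "proj_on (flat X) $$ (a * n + b, a' * n + b') = X $$ (a, b) * cnj (X $$ (a', b'))"
      using assms by (auto simp: proj_on_def flat_index[OF X] pair_index_less
          carrier_vecD[OF flat_carrier[OF X]])
  qed
  finally show ?thesis .
qed

text \<open>The weights are nonnegative, so an ensemble of trace zero has only members of weight
  zero. This is how outcomes of probability zero are recognised.\<close>

lemma trace_ens:
  assumes "set Xs \<subseteq> carrier_mat m n"
  shows "mat_trace (ens (m * n) Xs) = of_real (\<Sum>X\<leftarrow>Xs. frob X)"
proof -
  have "mat_trace (ens (m * n) Xs) = (\<Sum>a<m. \<Sum>b<n. \<Sum>X\<leftarrow>Xs. X $$ (a, b) * cnj (X $$ (a, b)))"
    unfolding mat_trace_def carrier_matD[OF sum_mats_carrier] ens_def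
    unfolding sum_pair_index ens_def[symmetric]
    by (intro sum.cong refl ens_index) (use assms in auto)
  also have "\<dots> = (\<Sum>X\<leftarrow>Xs. \<Sum>a<m. \<Sum>b<n. X $$ (a, b) * cnj (X $$ (a, b)))"
    by (simp only: sum_list_sum_swap)
  also have "\<dots> = (\<Sum>X\<leftarrow>Xs. of_real (frob X))"
    using assms by (intro arg_cong[where f = sum_list] map_cong refl)
      (auto simp: frob_def complex_norm_square simp del: of_real_power)
  also have "\<dots> = of_real (\<Sum>X\<leftarrow>Xs. frob X)"
    by (rule sum_list_of_real)
  finally show ?thesis .
qed

section \<open>Norms, completeness of instruments and the Schmidt bound\<close>

lemma sqnorm_nonneg [simp]: "0 \<le> sqnorm v"
  by (simp add: sqnorm_def sum_nonneg)

lemma frob_nonneg [simp]: "0 \<le> frob X"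
  by (simp add: frob_def sum_nonneg)

text \<open>The sum carries no conjugation because only moduli matter: the triangle inequality
  reduces it to the real inequality for \<open>L2_set\<close>.\<close>

lemma Cauchy_Schwarz_cmod:
  fixes u v :: "nat \<Rightarrow> complex"
  shows "(cmod (\<Sum>i<n. u i * v i))\<^sup>2 \<le> (\<Sum>i<n. (cmod (u i))\<^sup>2) * (\<Sum>i<n. (cmod (v i))\<^sup>2)"
proof -
  have "cmod (\<Sum>i<n. u i * v i) \<le> (\<Sum>i<n. \<bar>cmod (u i)\<bar> * \<bar>cmod (v i)\<bar>)"
    by (rule order_trans[OF norm_sum]) (simp add: norm_mult)
  also have "\<dots> \<le> L2_set (\<lambda>i. cmod (u i)) {..<n} * L2_set (\<lambda>i. cmod (v i)) {..<n}"
    by (rule L2_set_mult_ineq)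
  finally have "(cmod (\<Sum>i<n. u i * v i))\<^sup>2
      \<le> (L2_set (\<lambda>i. cmod (u i)) {..<n} * L2_set (\<lambda>i. cmod (v i)) {..<n})\<^sup>2"
    by (intro power_mono) auto
  then show ?thesis
    by (simp add: L2_set_def power_mult_distrib sum_nonneg)
qed

lemma mult_mat_vec_index:
  "K \<in> carrier_mat d n \<Longrightarrow> w \<in> carrier_vec n \<Longrightarrow> i < d
    \<Longrightarrow> (K *\<^sub>v w) $ i = (\<Sum>j<n. K $$ (i, j) * w $ j)"
  by (auto simp: scalar_prod_def atLeast0LessThan)

text \<open>Cauchy-Schwarz in each row: the operator norm is at most the Frobenius norm.\<close>

lemma sqnorm_mult_mat_vec_le:
  assumes "X \<in> carrier_mat m n" "v \<in> carrier_vec n"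
  shows "sqnorm (X *\<^sub>v v) \<le> frob X * sqnorm v"
proof -
  have "sqnorm (X *\<^sub>v v) = (\<Sum>i<m. (cmod (\<Sum>j<n. X $$ (i, j) * v $ j))\<^sup>2)"
    unfolding sqnorm_def using assms
    by (intro sum.cong) (auto simp: mult_mat_vec_index[OF assms] simp del: index_mult_mat_vec)
  also have "\<dots> \<le> (\<Sum>i<m. (\<Sum>j<n. (cmod (X $$ (i, j)))\<^sup>2) * (\<Sum>j<n. (cmod (v $ j))\<^sup>2))"
    by (intro sum_mono Cauchy_Schwarz_cmod)
  also have "\<dots> = frob X * sqnorm v"
    using assms by (auto simp: frob_def sqnorm_def sum_distrib_right)
  finally show ?thesis .
qed

lemma frob_eq_sum_cols: "frob X = (\<Sum>j<dim_col X. sqnorm (col X j))"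
  unfolding frob_def sqnorm_def by (subst sum.swap) simp

lemma frob_transpose [simp]: "frob (transpose_mat X) = frob X"
  unfolding frob_def by (subst sum.swap) simp

text \<open>The quadratic form of \<open>M\<close> at \<open>w\<close>. It is linear in
  \<open>M\<close>, so it can be applied to a completeness relation term by term.\<close>

definition quad :: "nat \<Rightarrow> complex vec \<Rightarrow> complex mat \<Rightarrow> complex" where
  "quad n w M = (\<Sum>i<n. \<Sum>j<n. cnj (w $ i) * M $$ (i, j) * w $ j)"

lemma quad_sum_mats: "quad n w (sum_mats n Ms) = (\<Sum>M\<leftarrow>Ms. quad n w M)"
proof -
  have "quad n w (sum_mats n Ms)
      = (\<Sum>i<n. \<Sum>j<n. \<Sum>M\<leftarrow>Ms. cnj (w $ i) * M $$ (i, j) * w $ j)"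
    unfolding quad_def by (intro sum.cong refl)
      (simp add: sum_mats_index sum_list_const_mult sum_list_mult_const)
  also have "\<dots> = (\<Sum>M\<leftarrow>Ms. quad n w M)"
    by (simp only: quad_def sum_list_sum_swap)
  finally show ?thesis .
qed

lemma quad_adjoint_mult:
  assumes K: "K \<in> carrier_mat d n" and w: "w \<in> carrier_vec n"
  shows "quad n w (mat_adjoint K * K) = of_real (sqnorm (K *\<^sub>v w))"
proof -
  have "quad n w (mat_adjoint K * K)
      = (\<Sum>i<n. \<Sum>j<n. \<Sum>k<d. cnj (K $$ (k, i) * w $ i) * (K $$ (k, j) * w $ j))"
    unfolding quad_def using K
    by (intro sum.cong refl)
      (simp add: scalar_prod_def atLeast0LessThan mat_adjoint_index sum_distrib_left mult_ac)
  also have "\<dots> = (\<Sum>i<n. \<Sum>k<d. \<Sum>j<n. cnj (K $$ (k, i) * w $ i) * (K $$ (k, j) * w $ j))"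
    by (intro sum.cong refl sum.swap)
  also have "\<dots> = (\<Sum>k<d. \<Sum>i<n. \<Sum>j<n. cnj (K $$ (k, i) * w $ i) * (K $$ (k, j) * w $ j))"
    by (rule sum.swap)
  also have "\<dots> = (\<Sum>k<d. cnj (\<Sum>j<n. K $$ (k, j) * w $ j) * (\<Sum>j<n. K $$ (k, j) * w $ j))"
    by (intro sum.cong refl) (simp add: sum_product)
  also have "\<dots> = (\<Sum>k<d. of_real ((cmod ((K *\<^sub>v w) $ k))\<^sup>2))"
    by (intro sum.cong refl)
      (simp add: mult_mat_vec_index[OF K w] complex_norm_square mult.commute
        del: of_real_power index_mult_mat_vec)
  also have "\<dots> = of_real (sqnorm (K *\<^sub>v w))"
    using K by (simp add: sqnorm_def del: of_real_power index_mult_mat_vec)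
  finally show ?thesis .
qed

lemma instrument_carrier:
  "instrument n es \<Longrightarrow> (d, Ks) \<in> set es \<Longrightarrow> K \<in> set Ks \<Longrightarrow> K \<in> carrier_mat d n"
  by (fastforce simp: instrument_def)

text \<open>The quadratic form at \<open>w\<close> is evaluated on both sides of the completeness
  relation: each summand gives the squared norm of \<open>K\<close> applied to \<open>w\<close>, and
  the identity matrix gives that of \<open>w\<close>.\<close>

lemma instrument_sqnorm:
  assumes es: "instrument n es" and w: "w \<in> carrier_vec n"
  shows "(\<Sum>K\<leftarrow>concat (map snd es). sqnorm (K *\<^sub>v w)) = sqnorm w"
proof -
  let ?Ks = "concat (map snd es)"
  have "[mat_adjoint K * K. (d, Ks) \<leftarrow> es, K \<leftarrow> Ks] = map (\<lambda>K. mat_adjoint K * K) ?Ks"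
    by (induction es) auto
  with es have "sum_mats n (map (\<lambda>K. mat_adjoint K * K) ?Ks) = 1\<^sub>m n"
    by (simp add: instrument_def)
  then have "quad n w (1\<^sub>m n) = quad n w (sum_mats n (map (\<lambda>K. mat_adjoint K * K) ?Ks))"
    by (simp only:)
  also have "\<dots> = (\<Sum>K\<leftarrow>?Ks. quad n w (mat_adjoint K * K))"
    by (simp only: quad_sum_mats map_map o_def)
  also have "\<dots> = (\<Sum>K\<leftarrow>?Ks. of_real (sqnorm (K *\<^sub>v w)))"
  proof (intro arg_cong[where f = sum_list] map_cong refl)
    fix K assume "K \<in> set ?Ks"
    then obtain d Ks where "(d, Ks) \<in> set es" "K \<in> set Ks" by auto
    then show "quad n w (mat_adjoint K * K) = of_real (sqnorm (K *\<^sub>v w))"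
      using quad_adjoint_mult[OF instrument_carrier[OF es] w] by blast
  qed
  also have "\<dots> = of_real (\<Sum>K\<leftarrow>?Ks. sqnorm (K *\<^sub>v w))"
    by (rule sum_list_of_real)
  also have "quad n w (1\<^sub>m n) = (\<Sum>i<n. \<Sum>j<n. if i = j then of_real ((cmod (w $ i))\<^sup>2) else 0)"
    unfolding quad_def by (intro sum.cong refl)
      (auto simp: complex_norm_square mult.commute simp del: of_real_power)
  also have "\<dots> = of_real (sqnorm w)"
    using w by (simp add: sqnorm_def sum.delta)
  finally show ?thesis by (simp only: of_real_eq_iff)
qed

text \<open>Conservation of the squared norm for each column of \<open>X\<close>, summed over the
  columns.\<close>

lemma instrument_frob:
  assumes es: "instrument n es" and X: "X \<in> carrier_mat n m"
  shows "(\<Sum>K\<leftarrow>concat (map snd es). frob (K * X)) = frob X"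
proof -
  let ?Ks = "concat (map snd es)"
  have "frob (K * X) = (\<Sum>j<m. sqnorm (K *\<^sub>v col X j))" if K: "K \<in> set ?Ks" for K
  proof -
    from K obtain d Ks where "(d, Ks) \<in> set es" "K \<in> set Ks" by auto
    then have "K \<in> carrier_mat d n" by (rule instrument_carrier[OF es])
    then have "col (K * X) j = K *\<^sub>v col X j" if "j < m" for j
      using X that by (rule col_mult2)
    then show ?thesis using X by (simp add: frob_eq_sum_cols)
  qed
  then have "(\<Sum>K\<leftarrow>?Ks. frob (K * X)) = (\<Sum>K\<leftarrow>?Ks. \<Sum>j<m. sqnorm (K *\<^sub>v col X j))"
    by (intro arg_cong[where f = sum_list] map_cong refl)
  also have "\<dots> = (\<Sum>j<m. \<Sum>K\<leftarrow>?Ks. sqnorm (K *\<^sub>v col X j))"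
    by (rule sum_list_sum_swap)
  also have "\<dots> = frob X"
    using X by (auto simp: instrument_sqnorm[OF es] frob_eq_sum_cols)
  finally show ?thesis .
qed

text \<open>The largest squared Schmidt coefficient is at most half of the weight \<open>frob X\<close>.\<close>

definition schmidt_le_half :: "complex mat \<Rightarrow> bool" where
  "schmidt_le_half X \<longleftrightarrow> (\<forall>v \<in> carrier_vec (dim_col X). sqnorm (X *\<^sub>v v) \<le> frob X / 2 * sqnorm v)"

text \<open>A matrix and its transpose have the same largest singular value. This makes the two
  parties interchangeable.\<close>

lemma schmidt_le_half_transpose:
  assumes "schmidt_le_half X"
  shows "schmidt_le_half (transpose_mat X)"
  unfolding schmidt_le_half_def
proof
  let ?F = "frob X / 2"
  obtain m n where X: "X \<in> carrier_mat m n" by blast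
  fix u :: "complex vec" assume "u \<in> carrier_vec (dim_col (transpose_mat X))"
  then have u: "u \<in> carrier_vec m" using X by simp
  \<comment> \<open>With this conjugate of \<open>transpose_mat X\<close> applied to
    \<open>u\<close>, the bilinear pairing of \<open>u\<close> with \<open>X\<close> applied to
    \<open>v\<close> equals \<open>sqnorm v\<close>. Cauchy-Schwarz and the bound for
    \<open>X\<close> at \<open>v\<close> then control it.\<close>
  define v where "v = vec n (\<lambda>j. cnj ((transpose_mat X *\<^sub>v u) $ j))"
  have v: "v \<in> carrier_vec n" by (simp add: v_def)
  have Tu: "(transpose_mat X *\<^sub>v u) $ j = (\<Sum>i<m. X $$ (i, j) * u $ i)" if "j < n" for j
    using that X u by (auto simp: scalar_prod_def atLeast0LessThan)
  have sv: "sqnorm (transpose_mat X *\<^sub>v u) = sqnorm v"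
    using X by (auto simp: sqnorm_def v_def simp del: index_mult_mat_vec)
  have "complex_of_real (sqnorm v) = (\<Sum>j<n. (\<Sum>i<m. X $$ (i, j) * u $ i) * v $ j)"
    by (simp add: sqnorm_def v_def Tu complex_norm_square mult.commute del: of_real_power index_mult_mat_vec)
  also have "\<dots> = (\<Sum>j<n. \<Sum>i<m. u $ i * (X $$ (i, j) * v $ j))"
    by (intro sum.cong refl) (simp add: sum_distrib_left sum_distrib_right mult_ac)
  also have "\<dots> = (\<Sum>i<m. \<Sum>j<n. u $ i * (X $$ (i, j) * v $ j))"
    by (rule sum.swap)
  also have "\<dots> = (\<Sum>i<m. u $ i * (X *\<^sub>v v) $ i)"
    by (intro sum.cong refl)
      (simp add: mult_mat_vec_index[OF X v] sum_distrib_left del: index_mult_mat_vec)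
  finally have "(sqnorm v)\<^sup>2 = (cmod (\<Sum>i<m. u $ i * (X *\<^sub>v v) $ i))\<^sup>2"
    by (metis norm_of_real power2_abs)
  also have "\<dots> \<le> sqnorm u * sqnorm (X *\<^sub>v v)"
    using Cauchy_Schwarz_cmod[of "\<lambda>i. u $ i" "\<lambda>i. (X *\<^sub>v v) $ i" m] u X
    by (auto simp: sqnorm_def simp del: index_mult_mat_vec)
  also have "\<dots> \<le> sqnorm u * (?F * sqnorm v)"
    using assms v X by (intro mult_left_mono) (auto simp: schmidt_le_half_def)
  finally have "sqnorm v * sqnorm v \<le> (?F * sqnorm u) * sqnorm v"
    by (simp add: power2_eq_square mult_ac)
  then have "sqnorm v \<le> ?F * sqnorm u"
    by (cases "sqnorm v = 0") (auto simp: mult_le_cancel_right less_le)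
  with sv show "sqnorm (transpose_mat X *\<^sub>v u) \<le> frob (transpose_mat X) / 2 * sqnorm u"
    by simp
qed

text \<open>Both sides of the bound are additive over the outcomes:
  \<open>sqnorm (X *\<^sub>v v)\<close> is the sum of its values after each \<open>K\<close>, and
  \<open>frob X\<close> is the sum of the \<open>frob (K * X)\<close>. As the bound is homogeneous,
  the outcomes need no normalisation.\<close>

lemma schmidt_le_half_instrument:
  assumes es: "instrument n es" and X: "X \<in> carrier_mat n m"
    and K: "\<And>d Ks K. (d, Ks) \<in> set es \<Longrightarrow> K \<in> set Ks \<Longrightarrow> schmidt_le_half (K * X)"
  shows "schmidt_le_half X"
  unfolding schmidt_le_half_def
proof
  let ?Ks = "concat (map snd es)"
  fix v :: "complex vec" assume "v \<in> carrier_vec (dim_col X)"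
  then have v: "v \<in> carrier_vec m" using X by simp
  then have Xv: "X *\<^sub>v v \<in> carrier_vec n" using X by simp
  have "sqnorm (X *\<^sub>v v) = (\<Sum>K\<leftarrow>?Ks. sqnorm (K *\<^sub>v (X *\<^sub>v v)))"
    by (rule instrument_sqnorm[OF es Xv, symmetric])
  also have "\<dots> \<le> (\<Sum>K\<leftarrow>?Ks. frob (K * X) / 2 * sqnorm v)"
  proof (rule sum_list_mono)
    fix L assume "L \<in> set ?Ks"
    then obtain d Ks where L: "(d, Ks) \<in> set es" "L \<in> set Ks" by auto
    then have "L \<in> carrier_mat d n" by (rule instrument_carrier[OF es])
    then have "L *\<^sub>v (X *\<^sub>v v) = (L * X) *\<^sub>v v" using X v by simp
    then show "sqnorm (L *\<^sub>v (X *\<^sub>v v)) \<le> frob (L * X) / 2 * sqnorm v"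
      using K[OF L] v X by (auto simp: schmidt_le_half_def)
  qed
  also have "\<dots> = (\<Sum>K\<leftarrow>?Ks. frob (K * X)) * (sqnorm v / 2)"
    by (simp flip: sum_list_mult_const)
  also have "\<dots> = frob X / 2 * sqnorm v"
    unfolding instrument_frob[OF es X] by simp
  finally show "sqnorm (X *\<^sub>v v) \<le> frob X / 2 * sqnorm v" .
qed

text \<open>Covers the branches of probability zero, on which the restoration condition imposes
  nothing.\<close>

lemma frob_zero_schmidt_le_half:
  assumes "frob X = 0"
  shows "schmidt_le_half X"
proof -
  have "sqnorm (X *\<^sub>v v) \<le> 0" if "v \<in> carrier_vec (dim_col X)" for v
    using sqnorm_mult_mat_vec_le[OF _ that, of X] assms by auto
  then show ?thesis using assms by (simp add: schmidt_le_half_def)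
qed

section \<open>Necessity: Bell pairs and induction over protocols\<close>

text \<open>Here \<open>X\<close> is the tensor product of the 2 by 2 identity with
  \<open>Y\<close>. It acts as \<open>Y\<close> on each half of \<open>v\<close>, so its squared
  operator norm is at most that of the Frobenius norm of one copy of \<open>Y\<close>, while
  \<open>frob X\<close> counts two copies.\<close>

lemma schmidt_le_half_block_diagonal:
  assumes X: "X \<in> carrier_mat (2 * p) (2 * q)"
    and Y: "\<And>a b x y. a < 2 \<Longrightarrow> b < 2 \<Longrightarrow> x < p \<Longrightarrow> y < q
      \<Longrightarrow> X $$ (a * p + x, b * q + y) = (if a = b then Y x y else 0)"
  shows "schmidt_le_half X"
  unfolding schmidt_le_half_def
proof
  let ?G = "\<Sum>x<p. \<Sum>y<q. (cmod (Y x y))\<^sup>2"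
  have two: "(\<Sum>a<2. f a) = f 0 + f (Suc 0)" for f :: "nat \<Rightarrow> 'a::comm_monoid_add"
    by (simp add: numeral_2_eq_2)
  have F: "frob X = 2 * ?G"
  proof -
    have "frob X = (\<Sum>a<2. \<Sum>x<p. \<Sum>b<2. \<Sum>y<q. (cmod (X $$ (a * p + x, b * q + y)))\<^sup>2)"
      using X by (simp add: frob_def sum_pair_index)
    also have "\<dots> = (\<Sum>a<(2::nat). \<Sum>x<p. \<Sum>b<2. \<Sum>y<q. if a = b then (cmod (Y x y))\<^sup>2 else 0)"
      by (intro sum.cong refl) (auto simp: Y)
    also have "\<dots> = 2 * ?G" by (simp add: two)
    finally show ?thesis .
  qed
  fix v :: "complex vec" assume "v \<in> carrier_vec (dim_col X)"
  then have v: "v \<in> carrier_vec (2 * q)" using X by simp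
  have "sqnorm (X *\<^sub>v v) = (\<Sum>a<2. \<Sum>x<p. (cmod (\<Sum>b<2. \<Sum>y<q. X $$ (a * p + x, b * q + y) * v $ (b * q + y)))\<^sup>2)"
    using X by (simp add: sqnorm_def mult_mat_vec_index[OF X v] sum_pair_index pair_index_less
        del: index_mult_mat_vec)
  also have "\<dots> = (\<Sum>a<2. \<Sum>x<p. (cmod (\<Sum>y<q. Y x y * v $ (a * q + y)))\<^sup>2)"
  proof (intro sum.cong refl)
    fix a x assume a: "a \<in> {..<2::nat}" and x: "x \<in> {..<p}"
    have "(\<Sum>b<2. \<Sum>y<q. X $$ (a * p + x, b * q + y) * v $ (b * q + y))
        = (\<Sum>b<2. \<Sum>y<q. if a = b then Y x y * v $ (b * q + y) else 0)"
      using a x by (intro sum.cong refl) (auto simp: Y)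
    also have "\<dots> = (\<Sum>y<q. Y x y * v $ (a * q + y))"
      using a by (auto simp: two less_2_cases_iff)
    finally show "(cmod (\<Sum>b<2. \<Sum>y<q. X $$ (a * p + x, b * q + y) * v $ (b * q + y)))\<^sup>2
        = (cmod (\<Sum>y<q. Y x y * v $ (a * q + y)))\<^sup>2" by simp
  qed
  also have "\<dots> \<le> (\<Sum>a<2. \<Sum>x<p. (\<Sum>y<q. (cmod (Y x y))\<^sup>2) * (\<Sum>y<q. (cmod (v $ (a * q + y)))\<^sup>2))"
    by (intro sum_mono Cauchy_Schwarz_cmod)
  also have "\<dots> = ?G * (\<Sum>a<2. \<Sum>y<q. (cmod (v $ (a * q + y)))\<^sup>2)"
    by (simp only: sum_distrib_left[symmetric] sum_distrib_right[symmetric])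
  also have "\<dots> = frob X / 2 * sqnorm v"
    using v by (simp add: F sqnorm_def sum_pair_index)
  finally show "sqnorm (X *\<^sub>v v) \<le> frob X / 2 * sqnorm v" .
qed

lemma reduced_AB_ens:
  assumes Xs: "set Xs \<subseteq> carrier_mat (2 * p) (2 * q)" and "i < 4" "j < 4"
  shows "reduced_AB p q (ens (2 * p * (2 * q)) Xs) $$ (i, j)
    = (\<Sum>X\<leftarrow>Xs. \<Sum>x<p. \<Sum>y<q. X $$ (i div 2 * p + x, i mod 2 * q + y)
        * cnj (X $$ (j div 2 * p + x, j mod 2 * q + y)))"
proof -
  have "reduced_AB p q (ens (2 * p * (2 * q)) Xs) $$ (i, j)
    = (\<Sum>x<p. \<Sum>y<q. \<Sum>X\<leftarrow>Xs. X $$ (i div 2 * p + x, i mod 2 * q + y)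
        * cnj (X $$ (j div 2 * p + x, j mod 2 * q + y)))"
    using assms by (auto simp: reduced_AB_def intro!: sum.cong ens_index[OF Xs, simplified] pair_index_less)
  also have "\<dots> = (\<Sum>X\<leftarrow>Xs. \<Sum>x<p. \<Sum>y<q. X $$ (i div 2 * p + x, i mod 2 * q + y)
        * cnj (X $$ (j div 2 * p + x, j mod 2 * q + y)))"
    by (simp only: sum_list_sum_swap)
  finally show ?thesis .
qed

lemma proj_Phi_plus:
  "proj_on Phi_plus = mat 4 4 (\<lambda>(i, j). if i \<in> {0, 3} \<and> j \<in> {0, 3} then 1 / 2 else 0)"
proof -
  have P: "Phi_plus = vec 4 (\<lambda>i. if i \<in> {0, 3} then of_real (1 / sqrt 2) else 0)"
    by (rule eq_vecI) (auto simp: Phi_plus_def ket_def bits_val_def)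
  have "complex_of_real (1 / sqrt 2) * cnj (of_real (1 / sqrt 2)) = 1 / 2"
    by (simp flip: of_real_mult)
  then show ?thesis
    unfolding P proj_on_def by (intro eq_matI) auto
qed

lemma sum_list_double_sum_cmod_zero:
  fixes f :: "'a \<Rightarrow> nat \<Rightarrow> nat \<Rightarrow> complex"
  assumes "(\<Sum>X\<leftarrow>Xs. \<Sum>x<p. \<Sum>y<q. f X x y * cnj (f X x y)) = 0"
    and "X \<in> set Xs" "x < p" "y < q"
  shows "f X x y = 0"
proof -
  have "(\<Sum>X\<leftarrow>Xs. \<Sum>x<p. \<Sum>y<q. f X x y * cnj (f X x y))
      = of_real (\<Sum>X\<leftarrow>Xs. \<Sum>x<p. \<Sum>y<q. (cmod (f X x y))\<^sup>2)"
    by (induction Xs) (simp_all add: complex_norm_square del: of_real_power)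
  with assms have "(\<Sum>X\<leftarrow>Xs. \<Sum>x<p. \<Sum>y<q. (cmod (f X x y))\<^sup>2) = 0"
    by (simp only: of_real_eq_0_iff)
  then have "(\<Sum>x<p. \<Sum>y<q. (cmod (f X x y))\<^sup>2) = 0"
    using assms(2) by (subst (asm) sum_list_nonneg_eq_0_iff) (auto intro!: sum_nonneg)
  then show ?thesis
    using assms(3,4) by (simp add: sum_nonneg_eq_0_iff sum_nonneg)
qed

text \<open>A pure reduced state forces every member of the ensemble to be that state tensored with
  something. In blocks indexed by the qubits A and B, the off-diagonal blocks of \<open>X\<close>
  vanish and the two diagonal blocks agree.\<close>

lemma Bell_pair_schmidt_le_half:
  assumes Xs: "set Xs \<subseteq> carrier_mat dA dB"
    and bell: "Bell_pair_on_AB dA dB (ens (dA * dB) Xs)"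
    and tr: "mat_trace (ens (dA * dB) Xs) \<noteq> 0" and X: "X \<in> set Xs"
  shows "schmidt_le_half X"
proof -
  from bell obtain p q where d: "dA = 2 * p" "dB = 2 * q"
    and R: "(1 / mat_trace (ens (dA * dB) Xs)) \<cdot>\<^sub>m reduced_AB p q (ens (dA * dB) Xs) = proj_on Phi_plus"
    by (auto simp: Bell_pair_on_AB_def)
  from Xs have Xs': "set Xs \<subseteq> carrier_mat (2 * p) (2 * q)" by (simp add: d)
  define r where "r i j = (\<Sum>X\<leftarrow>Xs. \<Sum>x<p. \<Sum>y<q. X $$ (i div 2 * p + x, i mod 2 * q + y)
        * cnj (X $$ (j div 2 * p + x, j mod 2 * q + y)))" for i j
  have r: "r i j = mat_trace (ens (dA * dB) Xs) * (if i \<in> {0, 3} \<and> j \<in> {0, 3} then 1 / 2 else 0)"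
    if "i < 4" "j < 4" for i j
  proof -
    have "1 / mat_trace (ens (dA * dB) Xs) * r i j = proj_on Phi_plus $$ (i, j)"
      using that reduced_AB_ens[OF Xs' that] unfolding R[symmetric] r_def d
      by (simp add: reduced_AB_def)
    then show ?thesis using tr that unfolding proj_Phi_plus by (auto simp: field_simps)
  qed
  \<comment> \<open>The labels 1 and 2 stand for |01> and |10>, where the Bell state has no weight;
    a vanishing diagonal entry of the reduced state is a vanishing sum of squared moduli.\<close>
  have z01: "X $$ (x, q + y) = 0" if "x < p" "y < q" for x y
    using r[of 1 1] sum_list_double_sum_cmod_zero[of "\<lambda>X x y. X $$ (x, q + y)", OF _ X that]
    by (simp add: r_def)
  have z10: "X $$ (p + x, y) = 0" if "x < p" "y < q" for x y
    using r[of 2 2] sum_list_double_sum_cmod_zero[of "\<lambda>X x y. X $$ (p + x, y)", OF _ X that]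
    by (simp add: r_def)
  \<comment> \<open>The difference of the diagonal blocks is the component along |00> - |11>, which
    is orthogonal to the Bell state, so its total weight is zero.\<close>
  define f where "f X x y = X $$ (x, y) - X $$ (p + x, q + y)" for X :: "complex mat" and x y
  have "(\<Sum>X\<leftarrow>Xs. \<Sum>x<p. \<Sum>y<q. f X x y * cnj (f X x y)) = r 0 0 + r 3 3 - r 0 3 - r 3 0"
    unfolding r_def f_def
    by (induction Xs) (simp_all add: algebra_simps sum.distrib sum_subtractf)
  also have "\<dots> = 0" by (simp add: r)
  finally have z11: "X $$ (x, y) = X $$ (p + x, q + y)" if "x < p" "y < q" for x y
    using sum_list_double_sum_cmod_zero[of f, OF _ X that] by (simp add: f_def)
  show ?thesis
  proof (rule schmidt_le_half_block_diagonal)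
    show "X \<in> carrier_mat (2 * p) (2 * q)" using X Xs' by auto
    fix a b x y :: nat assume "a < 2" "b < 2" "x < p" "y < q"
    then show "X $$ (a * p + x, b * q + y) = (if a = b then X $$ (x, y) else 0)"
      using z01 z10 z11 by (auto simp: less_2_cases_iff)
  qed
qed

lemma apply_kraus_left:
  assumes "set Ks \<subseteq> carrier_mat d m" "set Xs \<subseteq> carrier_mat m n"
  shows "apply_kraus (d * n) (map (\<lambda>K. tensor_mat K (1\<^sub>m n)) Ks) (ens (m * n) Xs)
    = ens (d * n) [K * X. K \<leftarrow> Ks, X \<leftarrow> Xs]"
  using assms by (intro apply_kraus_ens tensor_mat_carrier flat_carrier tensor_mat_flat_left) auto

lemma apply_kraus_right:
  assumes "set Ks \<subseteq> carrier_mat d n" "set Xs \<subseteq> carrier_mat m n"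
  shows "apply_kraus (m * d) (map (\<lambda>K. tensor_mat (1\<^sub>m m) K) Ks) (ens (m * n) Xs)
    = ens (m * d) [X * transpose_mat K. K \<leftarrow> Ks, X \<leftarrow> Xs]"
  using assms by (intro apply_kraus_ens tensor_mat_carrier flat_carrier tensor_mat_flat_right) auto

lemma restores_Alice_acts:
  "restores_Bell_pair (Alice_acts bs) dA dB \<rho> \<longleftrightarrow>
    (\<forall>(d, Ks, P) \<in> set bs. restores_Bell_pair P d dB
      (apply_kraus (d * dB) (map (\<lambda>K. tensor_mat K (1\<^sub>m dB)) Ks) \<rho>))"
  unfolding restores_Bell_pair_def
  by (subst final_branch.simps) fastforce

lemma restores_Bob_acts:
  "restores_Bell_pair (Bob_acts bs) dA dB \<rho> \<longleftrightarrow>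
    (\<forall>(d, Ks, P) \<in> set bs. restores_Bell_pair P dA d
      (apply_kraus (dA * d) (map (\<lambda>K. tensor_mat (1\<^sub>m dA) K) Ks) \<rho>))"
  unfolding restores_Bell_pair_def
  by (subst final_branch.simps) fastforce

lemma restores_Stop:
  "restores_Bell_pair Stop dA dB \<rho> \<longleftrightarrow> (mat_trace \<rho> \<noteq> 0 \<longrightarrow> Bell_pair_on_AB dA dB \<rho>)"
  unfolding restores_Bell_pair_def by (subst final_branch.simps) auto

text \<open>Induction from the leaves of the protocol back to its root. The claim concerns every
  member of every ensemble, since an outcome with several Kraus operators leaves a mixed state. At a
  node, each \<open>K * X\<close> belongs to the ensemble of some branch, and averaging over the
  outcomes carries the bound back to \<open>X\<close>.\<close>

lemma restores_imp_schmidt_le_half: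
  assumes "locc dA dB P" and "set Xs \<subseteq> carrier_mat dA dB"
    and "restores_Bell_pair P dA dB (ens (dA * dB) Xs)" and "X \<in> set Xs"
  shows "schmidt_le_half X"
  using assms
proof (induction arbitrary: Xs X rule: locc.induct)
  case (1 dA dB)
  show ?case
  proof (cases "mat_trace (ens (dA * dB) Xs) = 0")
    case True
    then have "(\<Sum>X\<leftarrow>Xs. frob X) = 0"
      by (simp only: trace_ens[OF 1(1)] of_real_eq_0_iff)
    then have "frob X = 0"
      using 1(3) by (subst (asm) sum_list_nonneg_eq_0_iff) auto
    then show ?thesis by (rule frob_zero_schmidt_le_half)
  next
    case False
    with 1 show ?thesis using Bell_pair_schmidt_le_half by (auto simp: restores_Stop)
  qed
next
  case (2 dA bs dB)
  let ?es = "map (\<lambda>(d, Ks, P). (d, Ks)) bs"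
  from 2 have X: "X \<in> carrier_mat dA dB" by auto
  show ?case
  proof (rule schmidt_le_half_instrument[OF 2(1) X])
    fix d Ks K assume dK: "(d, Ks) \<in> set ?es" and K: "K \<in> set Ks"
    then obtain P where P: "(d, Ks, P) \<in> set bs" by auto
    have Ks: "set Ks \<subseteq> carrier_mat d dA" using instrument_carrier[OF 2(1) dK] by auto
    show "schmidt_le_half (K * X)"
    proof (rule 2(2)[rule_format, OF P, simplified, THEN conjunct2, rule_format])
      show "set [K * X. K \<leftarrow> Ks, X \<leftarrow> Xs] \<subseteq> carrier_mat d dB"
        using Ks 2(3) by (auto intro!: mult_carrier_mat)
      show "restores_Bell_pair P d dB (ens (d * dB) [K * X. K \<leftarrow> Ks, X \<leftarrow> Xs])"
        using 2(4) P unfolding restores_Alice_acts apply_kraus_left[OF Ks 2(3), symmetric] by auto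
      show "K * X \<in> set [K * X. K \<leftarrow> Ks, X \<leftarrow> Xs]" using K 2(5) by auto
    qed
  qed
next
  case (3 dB bs dA)
  let ?es = "map (\<lambda>(d, Ks, P). (d, Ks)) bs"
  from 3 have X: "X \<in> carrier_mat dA dB" by auto
  \<comment> \<open>Bob's operators act on the columns of \<open>X\<close>, so the averaging
    argument is run on the transpose, on which they act from the left.\<close>
  have "schmidt_le_half (transpose_mat X)"
  proof (rule schmidt_le_half_instrument[OF 3(1)])
    show "transpose_mat X \<in> carrier_mat dB dA" using X by simp
    fix d Ks K assume dK: "(d, Ks) \<in> set ?es" and K: "K \<in> set Ks"
    then obtain P where P: "(d, Ks, P) \<in> set bs" by auto
    have Ks: "set Ks \<subseteq> carrier_mat d dB" using instrument_carrier[OF 3(1) dK] by auto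
    have "schmidt_le_half (X * transpose_mat K)"
    proof (rule 3(2)[rule_format, OF P, simplified, THEN conjunct2, rule_format])
      show "set [X * transpose_mat K. K \<leftarrow> Ks, X \<leftarrow> Xs] \<subseteq> carrier_mat dA d"
        using Ks 3(3) by (auto intro!: mult_carrier_mat)
      show "restores_Bell_pair P dA d (ens (dA * d) [X * transpose_mat K. K \<leftarrow> Ks, X \<leftarrow> Xs])"
        using 3(4) P unfolding restores_Bob_acts apply_kraus_right[OF Ks 3(3), symmetric] by auto
      show "X * transpose_mat K \<in> set [X * transpose_mat K. K \<leftarrow> Ks, X \<leftarrow> Xs]"
        using K 3(5) by auto
    qed
    then have "schmidt_le_half (transpose_mat (X * transpose_mat K))" by (rule schmidt_le_half_transpose)
    also have "transpose_mat (X * transpose_mat K) = K * transpose_mat X"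
      using X Ks K by (subst transpose_mult[of _ dA dB _ d]) auto
    finally show "schmidt_le_half (K * transpose_mat X)" .
  qed
  from schmidt_le_half_transpose[OF this] show ?case by simp
qed

section \<open>Sufficiency: a Bell pair from a state in Schmidt form\<close>

lemma mat_adjoint_mult_index:
  assumes "K \<in> carrier_mat d n" "a < n" "b < n"
  shows "(mat_adjoint K * K) $$ (a, b) = (\<Sum>r<d. cnj (K $$ (r, a)) * K $$ (r, b))"
  using assms by (auto simp: scalar_prod_def atLeast0LessThan mat_adjoint_index)

text \<open>Completeness entry by entry over the Kraus operators of all outcomes together, the form
  in which concrete instruments are verified.\<close>

lemma instrumentI:
  assumes carrier: "\<And>d Ks. (d, Ks) \<in> set es \<Longrightarrow> 0 < d \<and> set Ks \<subseteq> carrier_mat d n"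
    and complete: "\<And>a b. a < n \<Longrightarrow> b < n \<Longrightarrow>
      (\<Sum>K\<leftarrow>concat (map snd es). \<Sum>r<dim_row K. cnj (K $$ (r, a)) * K $$ (r, b))
        = (if a = b then 1 else 0)"
  shows "instrument n es"
proof -
  let ?Ks = "concat (map snd es)"
  have L: "[mat_adjoint K * K. (d, Ks) \<leftarrow> es, K \<leftarrow> Ks] = map (\<lambda>K. mat_adjoint K * K) ?Ks"
    by (induction es) auto
  have "sum_mats n (map (\<lambda>K. mat_adjoint K * K) ?Ks) = 1\<^sub>m n"
  proof (rule eq_matI)
    fix a b assume "a < dim_row (1\<^sub>m n)" "b < dim_col (1\<^sub>m n)"
    then have ab: "a < n" "b < n" by auto
    have "sum_mats n (map (\<lambda>K. mat_adjoint K * K) ?Ks) $$ (a, b)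
        = (\<Sum>K\<leftarrow>?Ks. (mat_adjoint K * K) $$ (a, b))"
      using ab by (simp add: sum_mats_index o_def)
    also have "\<dots> = (\<Sum>K\<leftarrow>?Ks. \<Sum>r<dim_row K. cnj (K $$ (r, a)) * K $$ (r, b))"
    proof (intro arg_cong[where f = sum_list] map_cong refl)
      fix K assume "K \<in> set ?Ks"
      then obtain d where "K \<in> carrier_mat d n" using carrier by fastforce
      then show "(mat_adjoint K * K) $$ (a, b) = (\<Sum>r<dim_row K. cnj (K $$ (r, a)) * K $$ (r, b))"
        using mat_adjoint_mult_index[of K d n a b] ab by auto
    qed
    finally show "sum_mats n (map (\<lambda>K. mat_adjoint K * K) ?Ks) $$ (a, b) = 1\<^sub>m n $$ (a, b)"
      using ab complete by simp
  qed (use carrier_matD[OF sum_mats_carrier] in auto)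
  with carrier L show ?thesis by (auto simp: instrument_def)
qed

lemma sum_lessThan_2: "(\<Sum>a<2. f a) = f 0 + f (1::nat)"
  for f :: "nat \<Rightarrow> 'a::comm_monoid_add"
  by (simp add: numeral_2_eq_2)

lemma sum_lessThan_4: "(\<Sum>a<4. f a) = f 0 + f 1 + f 2 + f (3::nat)"
  for f :: "nat \<Rightarrow> 'a::comm_monoid_add"
  by (simp add: eval_nat_numeral)

lemma sum_lessThan_8: "(\<Sum>a<8. f a) = f 0 + f 1 + f 2 + f 3 + f 4 + f 5 + f 6 + f (7::nat)"
  for f :: "nat \<Rightarrow> 'a::comm_monoid_add"
  by (simp add: eval_nat_numeral)

lemma less_4_cases: "a < (4::nat) \<Longrightarrow> a = 0 \<or> a = 1 \<or> a = 2 \<or> a = 3"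
  by auto

lemma less_8_cases:
  "a < (8::nat) \<Longrightarrow> a = 0 \<or> a = 1 \<or> a = 2 \<or> a = 3 \<or> a = 4 \<or> a = 5 \<or> a = 6 \<or> a = 7"
  by auto

lemma set_list_pairs:
  "y \<in> set [f a b. a \<leftarrow> as, b \<leftarrow> bs] \<longleftrightarrow> (\<exists>a \<in> set as. \<exists>b \<in> set bs. y = f a b)"
  by auto

text \<open>The coefficient matrix of the Bell state is a multiple of the identity, so all members
  are multiples, possibly zero, of the same pure state, and their mixture is that state up to its
  trace.\<close>

lemma restores_Stop_scalar:
  assumes Xs: "\<And>X. X \<in> set Xs \<Longrightarrow> \<exists>z. X = z \<cdot>\<^sub>m 1\<^sub>m 2"
  shows "restores_Bell_pair Stop 2 2 (ens (2 * 2) Xs)"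
  unfolding restores_Stop
proof
  have c: "set Xs \<subseteq> carrier_mat 2 2" using Xs by fastforce
  assume tr: "mat_trace (ens (2 * 2) Xs) \<noteq> 0"
  have "frob X = 2 * (cmod (X $$ (0, 0)))\<^sup>2" if "X \<in> set Xs" for X
    using Xs[OF that] by (auto simp: frob_def sum_lessThan_2)
  then have "(\<Sum>X\<leftarrow>Xs. frob X) = (\<Sum>X\<leftarrow>Xs. 2 * (cmod (X $$ (0, 0)))\<^sup>2)"
    by (intro arg_cong[where f = sum_list] map_cong refl)
  then have t: "mat_trace (ens (2 * 2) Xs) = of_real (\<Sum>X\<leftarrow>Xs. 2 * (cmod (X $$ (0, 0)))\<^sup>2)"
    by (simp only: trace_ens[OF c])
  \<comment> \<open>The systems accompanying A and B are one-dimensional.\<close>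
  have c1: "set Xs \<subseteq> carrier_mat (2 * 1) (2 * 1)" using c by simp
  have r: "reduced_AB 1 1 (ens (2 * 1 * (2 * 1)) Xs) $$ (i, j)
      = mat_trace (ens (2 * 2) Xs) * proj_on Phi_plus $$ (i, j)"
    if ij: "i < 4" "j < 4" for i j
  proof -
    have "reduced_AB 1 1 (ens (2 * 1 * (2 * 1)) Xs) $$ (i, j)
        = (\<Sum>X\<leftarrow>Xs. X $$ (i div 2, i mod 2) * cnj (X $$ (j div 2, j mod 2)))"
      unfolding reduced_AB_ens[OF c1 ij] by simp
    also have "\<dots> = (\<Sum>X\<leftarrow>Xs. of_real (2 * (cmod (X $$ (0, 0)))\<^sup>2) * proj_on Phi_plus $$ (i, j))"
    proof (intro arg_cong[where f = sum_list] map_cong refl)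
      fix X assume "X \<in> set Xs"
      then obtain z where "X = z \<cdot>\<^sub>m 1\<^sub>m 2" using Xs by blast
      then show "X $$ (i div 2, i mod 2) * cnj (X $$ (j div 2, j mod 2))
          = of_real (2 * (cmod (X $$ (0, 0)))\<^sup>2) * proj_on Phi_plus $$ (i, j)"
        using ij unfolding proj_Phi_plus of_real_mult complex_norm_square
        by (auto dest!: less_4_cases)
    qed
    also have "\<dots> = mat_trace (ens (2 * 2) Xs) * proj_on Phi_plus $$ (i, j)"
      unfolding t sum_list_mult_const sum_list_of_real ..
    finally show ?thesis .
  qed
  have "(1 / mat_trace (ens (2 * 2) Xs)) \<cdot>\<^sub>m reduced_AB 1 1 (ens (2 * 2) Xs) = proj_on Phi_plus"
  proof (rule eq_matI)
    fix i j assume "i < dim_row (proj_on Phi_plus)" "j < dim_col (proj_on Phi_plus)"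
    then have "i < 4" "j < 4" by (auto simp: proj_Phi_plus)
    then show "((1 / mat_trace (ens (2 * 2) Xs)) \<cdot>\<^sub>m reduced_AB 1 1 (ens (2 * 2) Xs)) $$ (i, j)
        = proj_on Phi_plus $$ (i, j)"
      using r tr by (simp add: reduced_AB_def)
  qed (auto simp: reduced_AB_def proj_Phi_plus)
  then show "Bell_pair_on_AB 2 2 (ens (2 * 2) Xs)"
    unfolding Bell_pair_on_AB_def by (intro exI[of _ 1]) simp
qed

text \<open>Dividing by \<open>\<mu>\<close> cancels the Schmidt coefficients: \<open>diag4 \<mu>\<close> becomes \<open>\<surd>q (|i\<rangle>|0\<rangle> + |j\<rangle>|1\<rangle>)\<close>.\<close>

definition bob_filter :: "(nat \<Rightarrow> real) \<Rightarrow> real \<Rightarrow> nat \<Rightarrow> nat \<Rightarrow> complex mat" where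
  "bob_filter \<mu> q i j = mat 2 4 (\<lambda>(r, c).
     if r = 0 \<and> c = i \<or> r = 1 \<and> c = j then of_real (sqrt q / \<mu> c) else 0)"

lemma bob_filter_dim [simp]:
  "dim_row (bob_filter \<mu> q i j) = 2" "dim_col (bob_filter \<mu> q i j) = 4"
  by (simp_all add: bob_filter_def)

text \<open>The first operator is |0><i| + |1><j|. The others send each remaining basis vector to
  |0>, which completes the instrument; they are zero for k in the pair.\<close>

definition alice_decode :: "nat \<Rightarrow> nat \<Rightarrow> complex mat list" where
  "alice_decode i j =
     mat 2 4 (\<lambda>(r, c). if r = 0 \<and> c = i \<or> r = 1 \<and> c = j then 1 else 0) #
     map (\<lambda>k. mat 2 4 (\<lambda>(r, c). if r = 0 \<and> c = k \<and> k \<noteq> i \<and> k \<noteq> j then 1 else 0)) [0, 1, 2, 3]"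

definition diag4 :: "(nat \<Rightarrow> real) \<Rightarrow> complex mat" where
  "diag4 \<mu> = mat 4 4 (\<lambda>(i, j). if i = j then of_real (\<mu> i) else 0)"

lemma alice_decode_carrier: "set (alice_decode i j) \<subseteq> carrier_mat 2 4"
  by (auto simp: alice_decode_def)

lemma instrument_alice_decode:
  assumes "i < j" "j < 4"
  shows "instrument 4 [(2, alice_decode i j)]"
proof (rule instrumentI)
  fix a b :: nat assume "a < 4" "b < 4"
  then have "a = 0 \<or> a = 1 \<or> a = 2 \<or> a = 3" "b = 0 \<or> b = 1 \<or> b = 2 \<or> b = 3"
    by auto
  moreover have "i = 0 \<and> j = 1 \<or> i = 0 \<and> j = 2 \<or> i = 0 \<and> j = 3
      \<or> i = 1 \<and> j = 2 \<or> i = 1 \<and> j = 3 \<or> i = 2 \<and> j = 3"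
    using assms by auto
  ultimately show "(\<Sum>K\<leftarrow>concat (map snd [(2::nat, alice_decode i j)]).
      \<Sum>r<dim_row K. cnj (K $$ (r, a)) * K $$ (r, b)) = (if a = b then 1 else 0)"
    by (elim disjE conjE) (simp_all add: alice_decode_def sum_lessThan_2)
qed (use alice_decode_carrier in auto)

lemma decode_filter_scalar:
  assumes ij: "i < j" "j < 4" and \<mu>: "\<And>k. k < 4 \<Longrightarrow> 0 < \<mu> k"
    and K: "K \<in> set (alice_decode i j)" and X: "X \<in> {diag4 \<mu>, 0\<^sub>m 4 4}"
  shows "\<exists>z. K * (X * transpose_mat (bob_filter \<mu> q i j)) = z \<cdot>\<^sub>m 1\<^sub>m 2"
proof -
  define Z where "Z = X * transpose_mat (bob_filter \<mu> q i j)"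
  define w where "w = (if X = 0\<^sub>m 4 4 then 0 else complex_of_real (sqrt q))"
  have Zc: "Z \<in> carrier_mat 4 2" using X by (auto simp: Z_def diag4_def bob_filter_def)
  have Z: "Z $$ (c, s) = (if c = (if s = 0 then i else j) then w else 0)" if cs: "c < 4" "s < 2" for c s
  proof -
    have nz: "\<mu> c \<noteq> 0" using \<mu>[OF cs(1)] by simp
    have "Z $$ (c, s) = (\<Sum>k<4. X $$ (c, k) * bob_filter \<mu> q i j $$ (s, k))"
      using X cs by (auto simp: Z_def diag4_def bob_filter_def scalar_prod_def atLeast0LessThan)
    also have "\<dots> = (if X = 0\<^sub>m 4 4 then 0
        else (\<Sum>k<4. if c = k then of_real (\<mu> c) * bob_filter \<mu> q i j $$ (s, c) else 0))"
    proof (cases "X = 0\<^sub>m 4 4")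
      case False
      then have "X = diag4 \<mu>" using X by simp
      then show ?thesis
        unfolding if_not_P[OF False] using cs by (intro sum.cong refl) (auto simp: diag4_def)
    qed (use cs in simp)
    also have "\<dots> = (if X = 0\<^sub>m 4 4 then 0 else of_real (\<mu> c) * bob_filter \<mu> q i j $$ (s, c))"
      using cs by simp
    also have "\<dots> = (if c = (if s = 0 then i else j) then w else 0)"
      using cs nz by (auto simp: w_def bob_filter_def less_2_cases_iff)
    finally show ?thesis .
  qed
  have Kc: "K \<in> carrier_mat 2 4" using K alice_decode_carrier by blast
  have KZ: "(K * Z) $$ (r, s) = K $$ (r, if s = 0 then i else j) * w" if "r < 2" "s < 2" for r s
  proof -
    have "(K * Z) $$ (r, s) = (\<Sum>c<4. K $$ (r, c) * Z $$ (c, s))"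
      using that Kc Zc by (auto simp: scalar_prod_def atLeast0LessThan)
    also have "\<dots> = (\<Sum>c<4. if c = (if s = 0 then i else j) then K $$ (r, c) * w else 0)"
      using that by (intro sum.cong refl) (simp add: Z)
    also have "\<dots> = K $$ (r, if s = 0 then i else j) * w"
      using ij by (subst sum.delta) auto
    finally show ?thesis .
  qed
  \<comment> \<open>On the columns i and j, the first operator of the list is the identity and all
    others vanish.\<close>
  have "K $$ (0, j) = 0" "K $$ (1, i) = 0" "K $$ (1, j) = K $$ (0, i)"
    using K ij by (auto simp: alice_decode_def)
  then have "K * Z = (K $$ (0, i) * w) \<cdot>\<^sub>m 1\<^sub>m 2"
    using KZ Kc Zc by (intro eq_matI) (auto simp: less_2_cases_iff)
  then show ?thesis unfolding Z_def by blast
qed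

lemma bob_filter_gram:
  assumes "i < j" "a < 4" "b < 4" "0 \<le> q"
  shows "(\<Sum>r<2. cnj (bob_filter \<mu> q i j $$ (r, a)) * bob_filter \<mu> q i j $$ (r, b))
    = of_real (if a = b \<and> (a = i \<or> a = j) then q / (\<mu> a)\<^sup>2 else 0)"
proof -
  have "complex_of_real (sqrt q) * of_real (sqrt q) = of_real q"
    using assms by (simp flip: of_real_mult)
  then show ?thesis
    using assms by (auto simp: sum_lessThan_2 bob_filter_def power2_eq_square)
qed

text \<open>The hypotheses \<open>s\<close> say that the squared Schmidt coefficients are the
  degrees of the edge weighting \<open>q\<close>. They are precisely the completeness relation of
  Bob's filters. An edge of weight zero gives a branch of probability zero.\<close>

lemma diag4_restorable:
  fixes \<mu> :: "nat \<Rightarrow> real" and q :: "nat \<Rightarrow> nat \<Rightarrow> real"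
  assumes \<mu>: "\<And>k. k < 4 \<Longrightarrow> 0 < \<mu> k" and q: "\<And>i j. 0 \<le> q i j"
    and s: "(\<mu> 0)\<^sup>2 = q 0 1 + q 0 2 + q 0 3" "(\<mu> 1)\<^sup>2 = q 0 1 + q 1 2 + q 1 3"
      "(\<mu> 2)\<^sup>2 = q 0 2 + q 1 2 + q 2 3" "(\<mu> 3)\<^sup>2 = q 0 3 + q 1 3 + q 2 3"
  shows "\<exists>P. locc 4 4 P \<and> restores_Bell_pair P 4 4 (ens (4 * 4) [diag4 \<mu>, 0\<^sub>m 4 4])"
proof -
  define pairs :: "(nat \<times> nat) list" where "pairs = [(0, 1), (0, 2), (0, 3), (1, 2), (1, 3), (2, 3)]"
  have pairs: "i < j \<and> j < 4" if "(i, j) \<in> set pairs" for i j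
    using that by (auto simp: pairs_def)
  define Q where "Q i j = Alice_acts [(2, alice_decode i j, Stop)]" for i j
  define bs where "bs = map (\<lambda>(i, j). (2::nat, [bob_filter \<mu> (q i j) i j], Q i j)) pairs"
  have "instrument 4 (map (\<lambda>(d, Ks, P). (d, Ks)) bs)"
  proof (rule instrumentI)
    fix a b :: nat assume ab: "a < 4" "b < 4"
    have "(\<Sum>K\<leftarrow>concat (map snd (map (\<lambda>(d, Ks, P). (d, Ks)) bs)).
        \<Sum>r<dim_row K. cnj (K $$ (r, a)) * K $$ (r, b))
      = (\<Sum>(i, j)\<leftarrow>pairs. \<Sum>r<2. cnj (bob_filter \<mu> (q i j) i j $$ (r, a))
          * bob_filter \<mu> (q i j) i j $$ (r, b))"
      by (simp add: bs_def pairs_def)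
    also have "\<dots> = (\<Sum>(i, j)\<leftarrow>pairs. of_real (if a = b \<and> (a = i \<or> a = j) then q i j / (\<mu> a)\<^sup>2 else 0))"
      by (intro arg_cong[where f = sum_list] map_cong refl)
        (auto dest!: pairs simp: bob_filter_gram[OF _ ab q])
    also have "\<dots> = (if a = b then of_real ((\<Sum>(i, j)\<leftarrow>pairs. if a = i \<or> a = j then q i j else 0) / (\<mu> a)\<^sup>2) else 0)"
      by (simp add: pairs_def add_divide_distrib)
    \<comment> \<open>The edges at the vertex \<open>a\<close> sum to its degree.\<close>
    also have "(\<Sum>(i, j)\<leftarrow>pairs. if a = i \<or> a = j then q i j else 0) = (\<mu> a)\<^sup>2"
      using less_4_cases[OF ab(1)] s by (auto simp: pairs_def)
    also have "(if a = b then complex_of_real ((\<mu> a)\<^sup>2 / (\<mu> a)\<^sup>2) else 0) = (if a = b then 1 else 0)"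
      using \<mu>[OF ab(1)] by auto
    finally show "(\<Sum>K\<leftarrow>concat (map snd (map (\<lambda>(d, Ks, P). (d, Ks)) bs)).
        \<Sum>r<dim_row K. cnj (K $$ (r, a)) * K $$ (r, b)) = (if a = b then 1 else 0)" .
  qed (auto simp: bs_def bob_filter_def)
  moreover have "locc 4 2 (Q i j)" if "(i, j) \<in> set pairs" for i j
    using instrument_alice_decode pairs[OF that] unfolding Q_def by (intro locc.intros) (auto intro: locc.intros)
  ultimately have "locc 4 4 (Bob_acts bs)"
    by (intro locc.intros) (auto simp: bs_def)
  moreover have "restores_Bell_pair (Bob_acts bs) 4 4 (ens (4 * 4) [diag4 \<mu>, 0\<^sub>m 4 4])"
    unfolding restores_Bob_acts
  proof (clarify)
    fix d Ks P assume "(d, Ks, P) \<in> set bs"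
    then obtain i j where ij: "(i, j) \<in> set pairs"
      and d: "d = 2" "Ks = [bob_filter \<mu> (q i j) i j]" "P = Q i j"
      by (auto simp: bs_def)
    let ?M = "bob_filter \<mu> (q i j) i j"
    let ?Xs = "[X * transpose_mat K. K \<leftarrow> [?M], X \<leftarrow> [diag4 \<mu>, 0\<^sub>m 4 4]]"
    have 1: "apply_kraus (4 * 2) (map (\<lambda>K. tensor_mat (1\<^sub>m 4) K) [?M]) (ens (4 * 4) [diag4 \<mu>, 0\<^sub>m 4 4])
        = ens (4 * 2) ?Xs"
      by (rule apply_kraus_right) (auto simp: bob_filter_def diag4_def)
    have 2: "apply_kraus (2 * 2) (map (\<lambda>K. tensor_mat K (1\<^sub>m 2)) (alice_decode i j)) (ens (4 * 2) ?Xs)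
        = ens (2 * 2) [K * X. K \<leftarrow> alice_decode i j, X \<leftarrow> ?Xs]"
      by (rule apply_kraus_left) (use alice_decode_carrier in \<open>auto simp: bob_filter_def diag4_def\<close>)
    have 3: "restores_Bell_pair Stop 2 2 (ens (2 * 2) [K * X. K \<leftarrow> alice_decode i j, X \<leftarrow> ?Xs])"
    proof (rule restores_Stop_scalar)
      fix Y assume "Y \<in> set [K * X. K \<leftarrow> alice_decode i j, X \<leftarrow> ?Xs]"
      then obtain K Z where K: "K \<in> set (alice_decode i j)" and Z: "Z \<in> set ?Xs" "Y = K * Z"
        unfolding set_list_pairs[of _ "\<lambda>K X. K * X"] by blast
      moreover from Z(1) obtain X where "X \<in> {diag4 \<mu>, 0\<^sub>m 4 4}" "Z = X * transpose_mat ?M"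
        unfolding set_list_pairs[of _ "\<lambda>K X. X * transpose_mat K"] by (auto simp only: list.set)
      ultimately have "K \<in> set (alice_decode i j)" "X \<in> {diag4 \<mu>, 0\<^sub>m 4 4}"
        "Y = K * (X * transpose_mat ?M)"
        by blast+
      then show "\<exists>z. Y = z \<cdot>\<^sub>m 1\<^sub>m 2" using decode_filter_scalar \<mu> pairs[OF ij] by blast
    qed
    show "restores_Bell_pair P 4 d (apply_kraus (4 * d) (map (\<lambda>K. tensor_mat (1\<^sub>m 4) K) Ks)
        (ens (4 * 4) [diag4 \<mu>, 0\<^sub>m 4 4]))"
      unfolding d 1 Q_def restores_Alice_acts using 2 3 by simp
  qed
  ultimately show ?thesis by blast
qed

section \<open>The transfer state and its reduction to Schmidt form\<close>

text \<open>The row index encodes A in \<open>i div 4\<close> and A', K in \<open>i mod 4\<close>;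
  the column index encodes B in \<open>j div 2\<close> and B' in \<open>j mod 2\<close>.\<close>

definition W_matrix :: "real \<Rightarrow> real \<Rightarrow> real \<Rightarrow> real \<Rightarrow> complex mat" where
  "W_matrix \<theta> \<alpha> \<beta> \<gamma> = mat 8 4 (\<lambda>(i, j).
     if i div 4 = j div 2 then of_real ((if j div 2 = 0 then cos \<theta> else sin \<theta>) *
       (if i mod 4 = 0 \<and> j mod 2 = 1 then \<beta> else if i mod 4 = 1 \<and> j mod 2 = 0 then \<alpha>
        else if i mod 4 = 2 \<and> j mod 2 = 0 then \<gamma> else 0)) else 0)"

lemma link_state_index:
  assumes "i < 4"
  shows "link_state \<theta> $ i = of_real (if i = 0 then cos \<theta> else if i = 3 then sin \<theta> else 0)"
  using assms by (auto simp: link_state_def ket_def bits_val_def)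

lemma W_state_index:
  assumes "i < 8"
  shows "W_state \<alpha> \<beta> \<gamma> $ i
    = of_real (if i = 1 then \<alpha> else if i = 2 then \<beta> else if i = 4 then \<gamma> else 0)"
  using assms by (auto simp: W_state_def ket_def bits_val_def)

lemma global_state_index:
  assumes "i < 32"
  shows "global_state \<theta> \<alpha> \<beta> \<gamma> $ i = link_state \<theta> $ (i div 8) * W_state \<alpha> \<beta> \<gamma> $ (i mod 8)"
proof -
  have "dim_vec (link_state \<theta>) = 4" "dim_vec (W_state \<alpha> \<beta> \<gamma>) = 8"
    by (simp_all add: link_state_def W_state_def ket_def)
  with assms show ?thesis by (simp add: global_state_def tensor_vec_def)
qed

lemma W_matrix_dim [simp]:
  "dim_row (W_matrix \<theta> \<alpha> \<beta> \<gamma>) = 8" "dim_col (W_matrix \<theta> \<alpha> \<beta> \<gamma>) = 4"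
  by (simp_all add: W_matrix_def)

lemma W_matrix_index:
  assumes "i < 8" "j < 4"
  shows "W_matrix \<theta> \<alpha> \<beta> \<gamma> $$ (i, j) =
    (if i div 4 = j div 2 then of_real ((if j div 2 = 0 then cos \<theta> else sin \<theta>) *
       (if i mod 4 = 0 \<and> j mod 2 = 1 then \<beta> else if i mod 4 = 1 \<and> j mod 2 = 0 then \<alpha>
        else if i mod 4 = 2 \<and> j mod 2 = 0 then \<gamma> else 0)) else 0)"
  using assms unfolding W_matrix_def by (simp only: index_mat prod.case)

lemma flat_W_matrix_index:
  "i < 32 \<Longrightarrow> flat (W_matrix \<theta> \<alpha> \<beta> \<gamma>) $ i = W_matrix \<theta> \<alpha> \<beta> \<gamma> $$ (i div 4, i mod 4)"
  by (simp add: flat_def)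

lemma transfer_state_index:
  "i < 32 \<Longrightarrow> transfer_state \<theta> \<alpha> \<beta> \<gamma> $ i = global_state \<theta> \<alpha> \<beta> \<gamma> $
     bits_val [i div 16 mod 2, i div 2 mod 2, i div 8 mod 2, i mod 2, i div 4 mod 2]"
  unfolding transfer_state_def Let_def by (subst index_vec) auto

lemma transfer_state_eq_flat: "transfer_state \<theta> \<alpha> \<beta> \<gamma> = flat (W_matrix \<theta> \<alpha> \<beta> \<gamma>)"
proof (rule eq_vecI)
  show "dim_vec (transfer_state \<theta> \<alpha> \<beta> \<gamma>) = dim_vec (flat (W_matrix \<theta> \<alpha> \<beta> \<gamma>))"
    by (simp add: transfer_state_def flat_def W_matrix_def)
  fix i assume "i < dim_vec (flat (W_matrix \<theta> \<alpha> \<beta> \<gamma>))"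
  then have "i < 32" by (simp add: flat_def W_matrix_def)
  \<comment> \<open>The index is split into its five binary digits, which leaves 32 concrete
    cases.\<close>
  define i1 where "i1 = i div 2"
  define i2 where "i2 = i1 div 2"
  define i3 where "i3 = i2 div 2"
  define i4 where "i4 = i3 div 2"
  have "i = 2 * i1 + i mod 2" "i1 = 2 * i2 + i1 mod 2" "i2 = 2 * i3 + i2 mod 2"
    "i3 = 2 * i4 + i3 mod 2"
    by (simp_all add: i1_def i2_def i3_def i4_def)
  then have "i = 16 * i4 + 8 * (i3 mod 2) + 4 * (i2 mod 2) + 2 * (i1 mod 2) + i mod 2"
    by linarith
  moreover from this \<open>i < 32\<close> have "i4 < 2" by linarith
  moreover have "i3 mod 2 < 2" "i2 mod 2 < 2" "i1 mod 2 < 2" "i mod 2 < 2" by simp_all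
  ultimately obtain a a' k b b' where i: "i = 16 * a + 8 * a' + 4 * k + 2 * b + b'"
    and bits: "a < 2" "a' < 2" "k < 2" "b < 2" "b' < 2" by blast
  show "transfer_state \<theta> \<alpha> \<beta> \<gamma> $ i = flat (W_matrix \<theta> \<alpha> \<beta> \<gamma>) $ i"
    using bits[unfolded less_2_cases_iff] unfolding i
    by (elim disjE) (simp_all add: transfer_state_index bits_val_def global_state_index
        link_state_index W_state_index flat_W_matrix_index W_matrix_index)
qed

lemma proj_on_transfer_state:
  "proj_on (transfer_state \<theta> \<alpha> \<beta> \<gamma>) = ens (8 * 4) [W_matrix \<theta> \<alpha> \<beta> \<gamma>]"
proof -
  have "proj_on (flat (W_matrix \<theta> \<alpha> \<beta> \<gamma>)) \<in> carrier_mat (8 * 4) (8 * 4)"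
    by (intro proj_on_carrier flat_carrier) (simp add: W_matrix_def)
  then show ?thesis
    unfolding transfer_state_eq_flat ens_def by (simp del: proj_on_carrier)
qed

lemma W_matrix_carrier: "W_matrix \<theta> \<alpha> \<beta> \<gamma> \<in> carrier_mat 8 4"
  by (simp add: W_matrix_def)

text \<open>The columns have disjoint supports, so these are the four squared Schmidt
  coefficients.\<close>

lemma sqnorm_col_W_matrix:
  "sqnorm (col (W_matrix \<theta> \<alpha> \<beta> \<gamma>) 0) = (cos \<theta>)\<^sup>2 * (\<alpha>\<^sup>2 + \<gamma>\<^sup>2)"
  "sqnorm (col (W_matrix \<theta> \<alpha> \<beta> \<gamma>) 1) = (cos \<theta>)\<^sup>2 * \<beta>\<^sup>2"
  "sqnorm (col (W_matrix \<theta> \<alpha> \<beta> \<gamma>) 2) = (sin \<theta>)\<^sup>2 * (\<alpha>\<^sup>2 + \<gamma>\<^sup>2)"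
  "sqnorm (col (W_matrix \<theta> \<alpha> \<beta> \<gamma>) 3) = (sin \<theta>)\<^sup>2 * \<beta>\<^sup>2"
  by (simp_all add: sqnorm_def W_matrix_def sum_lessThan_8 norm_mult power_mult_distrib algebra_simps)

lemma frob_W_matrix:
  assumes "\<alpha>\<^sup>2 + \<beta>\<^sup>2 + \<gamma>\<^sup>2 = 1"
  shows "frob (W_matrix \<theta> \<alpha> \<beta> \<gamma>) = 1"
proof -
  have "frob (W_matrix \<theta> \<alpha> \<beta> \<gamma>) = (\<Sum>j<4. sqnorm (col (W_matrix \<theta> \<alpha> \<beta> \<gamma>) j))"
    using W_matrix_carrier by (simp add: frob_eq_sum_cols W_matrix_def)
  also have "\<dots> = ((cos \<theta>)\<^sup>2 + (sin \<theta>)\<^sup>2) * (\<alpha>\<^sup>2 + \<beta>\<^sup>2 + \<gamma>\<^sup>2)"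
    by (simp only: sum_lessThan_4 sqnorm_col_W_matrix ring_distribs ac_simps)
  also have "\<dots> = 1" using assms by simp
  finally show ?thesis .
qed

text \<open>The Schmidt bound tested at a basis vector.\<close>

lemma schmidt_le_half_col:
  assumes "schmidt_le_half X" "X \<in> carrier_mat m n" "j < n"
  shows "sqnorm (col X j) \<le> frob X / 2"
proof -
  have "(\<Sum>i<n. (cmod (unit_vec n j $ i))\<^sup>2) = (\<Sum>i<n. if i = j then 1 else 0)"
    using assms(3) by (intro sum.cong) auto
  then have "sqnorm (unit_vec n j) = 1" using assms(3) by (simp add: sqnorm_def)
  moreover have "X *\<^sub>v unit_vec n j = col X j" using assms by (intro eq_vecI) auto
  ultimately show ?thesis
    using assms(1)[unfolded schmidt_le_half_def, rule_format, of "unit_vec n j"] assms(2) by auto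
qed

text \<open>
  Alice's Schmidt vectors are \<open>|a\<rangle> \<otimes> (\<alpha>|01\<rangle> + \<gamma>|10\<rangle>) / \<nu>\<close> and \<open>|a\<rangle> \<otimes> |00\<rangle>\<close> on \<open>A, A', K\<close>. With
  \<open>x = \<alpha> / \<nu>\<close>, \<open>y = \<gamma> / \<nu>\<close> the first operator maps them to the basis of a four-dimensional system, and the
  second one is supported on their orthogonal complement.
\<close>

definition alice_compress :: "real \<Rightarrow> real \<Rightarrow> complex mat" where
  "alice_compress x y = mat 4 8 (\<lambda>(r, i). if r div 2 = i div 4 then
     (if r mod 2 = 1 \<and> i mod 4 = 0 then 1 else if r mod 2 = 0 \<and> i mod 4 = 1 then of_real x
      else if r mod 2 = 0 \<and> i mod 4 = 2 then of_real y else 0) else 0)"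

definition alice_rest :: "real \<Rightarrow> real \<Rightarrow> complex mat" where
  "alice_rest x y = mat 4 8 (\<lambda>(r, i). if r div 2 = i div 4 then
     (if r mod 2 = 1 \<and> i mod 4 = 3 then 1 else if r mod 2 = 0 \<and> i mod 4 = 1 then of_real y
      else if r mod 2 = 0 \<and> i mod 4 = 2 then - of_real x else 0) else 0)"

lemma alice_kraus_dim [simp]:
  "dim_row (alice_compress x y) = 4" "dim_col (alice_compress x y) = 8"
  "dim_row (alice_rest x y) = 4" "dim_col (alice_rest x y) = 8"
  by (simp_all add: alice_compress_def alice_rest_def)

lemma alice_compress_rows:
  assumes "i < 8"
  shows "alice_compress x y $$ (0, i) = (if i = 1 then of_real x else if i = 2 then of_real y else 0)"
    "alice_compress x y $$ (1, i) = (if i = 0 then 1 else 0)"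
    "alice_compress x y $$ (2, i) = (if i = 5 then of_real x else if i = 6 then of_real y else 0)"
    "alice_compress x y $$ (3, i) = (if i = 4 then 1 else 0)"
  using less_8_cases[OF assms] by (elim disjE; simp add: alice_compress_def)+

lemma alice_rest_rows:
  assumes "i < 8"
  shows "alice_rest x y $$ (0, i) = (if i = 1 then of_real y else if i = 2 then - of_real x else 0)"
    "alice_rest x y $$ (1, i) = (if i = 3 then 1 else 0)"
    "alice_rest x y $$ (2, i) = (if i = 5 then of_real y else if i = 6 then - of_real x else 0)"
    "alice_rest x y $$ (3, i) = (if i = 7 then 1 else 0)"
  using less_8_cases[OF assms] by (elim disjE; simp add: alice_rest_def)+

text \<open>The rows of the two operators together form an orthonormal basis of the
  eight-dimensional space.\<close>

lemma instrument_alice_compress: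
  assumes "x\<^sup>2 + y\<^sup>2 = 1"
  shows "instrument 8 [(4, [alice_compress x y, alice_rest x y])]"
proof (rule instrumentI)
  fix a b :: nat assume ab: "a < 8" "b < 8"
  have xy: "complex_of_real x * of_real x + of_real y * of_real y = 1"
    "complex_of_real y * of_real y + of_real x * of_real x = 1"
    using assms by (simp_all flip: of_real_mult of_real_add add: power2_eq_square add.commute)
  have "(\<Sum>K\<leftarrow>concat (map snd [(4::nat, [alice_compress x y, alice_rest x y])]).
      \<Sum>r<dim_row K. cnj (K $$ (r, a)) * K $$ (r, b))
    = (\<Sum>r<4. cnj (alice_compress x y $$ (r, a)) * alice_compress x y $$ (r, b))
      + (\<Sum>r<4. cnj (alice_rest x y $$ (r, a)) * alice_rest x y $$ (r, b))"
    by (simp add: alice_compress_def alice_rest_def)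
  also have "\<dots> = (if a = b then 1 else 0)"
    unfolding sum_lessThan_4 ab[THEN alice_compress_rows(1)] ab[THEN alice_compress_rows(2)]
      ab[THEN alice_compress_rows(3)] ab[THEN alice_compress_rows(4)]
      ab[THEN alice_rest_rows(1)] ab[THEN alice_rest_rows(2)]
      ab[THEN alice_rest_rows(3)] ab[THEN alice_rest_rows(4)]
    using ab[THEN less_8_cases] by (elim disjE) (simp_all add: xy)
  finally show "(\<Sum>K\<leftarrow>concat (map snd [(4::nat, [alice_compress x y, alice_rest x y])]).
      \<Sum>r<dim_row K. cnj (K $$ (r, a)) * K $$ (r, b)) = (if a = b then 1 else 0)" .
qed (auto simp: alice_compress_def alice_rest_def)

text \<open>\<open>\<nu>\<close> stands for the square root of
  \<open>\<alpha>\<^sup>2 + \<gamma>\<^sup>2\<close>; the order is that of the columns of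
  \<open>W_matrix\<close>.\<close>

definition schmidt :: "real \<Rightarrow> real \<Rightarrow> real \<Rightarrow> nat \<Rightarrow> real" where
  "schmidt \<theta> \<beta> \<nu> k = (if k div 2 = 0 then cos \<theta> else sin \<theta>) * (if k mod 2 = 0 then \<nu> else \<beta>)"

lemma alice_compress_W_matrix:
  assumes "\<nu> \<noteq> 0" "\<alpha>\<^sup>2 + \<gamma>\<^sup>2 = \<nu>\<^sup>2"
  shows "alice_compress (\<alpha> / \<nu>) (\<gamma> / \<nu>) * W_matrix \<theta> \<alpha> \<beta> \<gamma> = diag4 (schmidt \<theta> \<beta> \<nu>)"
    and "alice_rest (\<alpha> / \<nu>) (\<gamma> / \<nu>) * W_matrix \<theta> \<alpha> \<beta> \<gamma> = 0\<^sub>m 4 4"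
proof -
  have "\<alpha> * \<alpha> / \<nu> + \<gamma> * \<gamma> / \<nu> = \<nu>"
    using assms by (simp add: power2_eq_square flip: add_divide_distrib)
  then have "complex_of_real (\<alpha> * \<alpha> / \<nu> + \<gamma> * \<gamma> / \<nu>) = of_real \<nu>" by simp
  then have e: "of_real \<alpha> * of_real \<alpha> / complex_of_real \<nu> + of_real \<gamma> * of_real \<gamma> / of_real \<nu> = of_real \<nu>"
    by simp
  have e': "of_real \<alpha> * (z * of_real \<alpha>) / complex_of_real \<nu> + of_real \<gamma> * (z * of_real \<gamma>) / of_real \<nu>
      = z * of_real \<nu>" for z
  proof -
    have "of_real \<alpha> * (z * of_real \<alpha>) / complex_of_real \<nu> + of_real \<gamma> * (z * of_real \<gamma>) / of_real \<nu>
        = z * (of_real \<alpha> * of_real \<alpha> / complex_of_real \<nu> + of_real \<gamma> * of_real \<gamma> / of_real \<nu>)"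
      by (simp add: distrib_left mult_ac)
    then show ?thesis by (simp only: e)
  qed
  show "alice_compress (\<alpha> / \<nu>) (\<gamma> / \<nu>) * W_matrix \<theta> \<alpha> \<beta> \<gamma> = diag4 (schmidt \<theta> \<beta> \<nu>)"
  proof (rule eq_matI)
    fix i j assume "i < dim_row (diag4 (schmidt \<theta> \<beta> \<nu>))" "j < dim_col (diag4 (schmidt \<theta> \<beta> \<nu>))"
    then have ij: "i < 4" "j < 4" by (auto simp: diag4_def)
    then have "(alice_compress (\<alpha> / \<nu>) (\<gamma> / \<nu>) * W_matrix \<theta> \<alpha> \<beta> \<gamma>) $$ (i, j)
      = (\<Sum>k<8. alice_compress (\<alpha> / \<nu>) (\<gamma> / \<nu>) $$ (i, k) * W_matrix \<theta> \<alpha> \<beta> \<gamma> $$ (k, j))"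
      by (simp add: scalar_prod_def atLeast0LessThan)
    also have "\<dots> = diag4 (schmidt \<theta> \<beta> \<nu>) $$ (i, j)"
      unfolding sum_lessThan_8 using ij[THEN less_4_cases]
      by (elim disjE) (simp_all add: alice_compress_rows W_matrix_index diag4_def schmidt_def e'
          alice_compress_rows(2)[unfolded One_nat_def])
    finally show "(alice_compress (\<alpha> / \<nu>) (\<gamma> / \<nu>) * W_matrix \<theta> \<alpha> \<beta> \<gamma>) $$ (i, j)
      = diag4 (schmidt \<theta> \<beta> \<nu>) $$ (i, j)" .
  qed (simp_all add: diag4_def)
  show "alice_rest (\<alpha> / \<nu>) (\<gamma> / \<nu>) * W_matrix \<theta> \<alpha> \<beta> \<gamma> = 0\<^sub>m 4 4"
  proof (rule eq_matI)
    fix i j assume "i < dim_row (0\<^sub>m 4 4 :: complex mat)" "j < dim_col (0\<^sub>m 4 4 :: complex mat)"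
    then have ij: "i < 4" "j < 4" by auto
    then have "(alice_rest (\<alpha> / \<nu>) (\<gamma> / \<nu>) * W_matrix \<theta> \<alpha> \<beta> \<gamma>) $$ (i, j)
      = (\<Sum>k<8. alice_rest (\<alpha> / \<nu>) (\<gamma> / \<nu>) $$ (i, k) * W_matrix \<theta> \<alpha> \<beta> \<gamma> $$ (k, j))"
      by (simp add: scalar_prod_def atLeast0LessThan)
    also have "\<dots> = 0"
      unfolding sum_lessThan_8 using ij[THEN less_4_cases]
      by (elim disjE) (simp_all add: alice_rest_rows W_matrix_index alice_rest_rows(2)[unfolded One_nat_def])
    finally show "(alice_rest (\<alpha> / \<nu>) (\<gamma> / \<nu>) * W_matrix \<theta> \<alpha> \<beta> \<gamma>) $$ (i, j) = 0\<^sub>m 4 4 $$ (i, j)"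
      using ij by simp
  qed simp_all
qed

text \<open>Alice's compression is put in front of \<open>P\<close>. Both of its Kraus operators
  form a single outcome, hence the zero matrix next to the diagonal one.\<close>

lemma transfer_restorable_if_diag4:
  assumes \<nu>: "\<nu> \<noteq> 0" "\<alpha>\<^sup>2 + \<gamma>\<^sup>2 = \<nu>\<^sup>2"
    and P: "locc 4 4 P" "restores_Bell_pair P 4 4 (ens (4 * 4) [diag4 (schmidt \<theta> \<beta> \<nu>), 0\<^sub>m 4 4])"
  shows "transfer_restorable \<theta> \<alpha> \<beta> \<gamma>"
proof -
  let ?Ks = "[alice_compress (\<alpha> / \<nu>) (\<gamma> / \<nu>), alice_rest (\<alpha> / \<nu>) (\<gamma> / \<nu>)]"
  have "(\<alpha> / \<nu>)\<^sup>2 + (\<gamma> / \<nu>)\<^sup>2 = 1"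
    using \<nu> by (simp add: power_divide flip: add_divide_distrib)
  then have "locc 8 4 (Alice_acts [(4, ?Ks, P)])"
    using instrument_alice_compress P(1) by (intro locc.intros) auto
  moreover have "apply_kraus (4 * 4) (map (\<lambda>K. tensor_mat K (1\<^sub>m 4)) ?Ks) (ens (8 * 4) [W_matrix \<theta> \<alpha> \<beta> \<gamma>])
      = ens (4 * 4) [K * X. K \<leftarrow> ?Ks, X \<leftarrow> [W_matrix \<theta> \<alpha> \<beta> \<gamma>]]"
    by (rule apply_kraus_left) (auto simp: alice_compress_def alice_rest_def W_matrix_def)
  then have "restores_Bell_pair (Alice_acts [(4, ?Ks, P)]) 8 4 (proj_on (transfer_state \<theta> \<alpha> \<beta> \<gamma>))"
    unfolding proj_on_transfer_state restores_Alice_acts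
    using P(2) alice_compress_W_matrix[OF \<nu>] by simp
  ultimately show ?thesis unfolding transfer_restorable_def by blast
qed

section \<open>Edge weights and the criterion\<close>

text \<open>The vertex of smallest degree is joined only to the one of largest degree. The remaining
  degrees then determine the weights on the triangle of the other three vertices, each as half of a
  sum of two degrees minus the third.\<close>

lemma pair_weights_exist:
  fixes c s b :: real
  assumes cs: "c + s = 1" "0 \<le> s" "s \<le> c" and b: "0 \<le> b" "b \<le> 1"
    and "c * b \<le> 1 / 2" "c * (1 - b) \<le> 1 / 2"
  shows "\<exists>q. (\<forall>i j. 0 \<le> q i j)
    \<and> c * (1 - b) = q 0 1 + q 0 2 + q (0::nat) (3::nat) \<and> c * b = q 0 1 + q 1 2 + q 1 3
    \<and> s * (1 - b) = q 0 2 + q 1 2 + q 2 3 \<and> s * b = q 0 3 + q 1 3 + q 2 3"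
proof -
  \<comment> \<open>The default 0 is the weight of the edge {2, 3} and of all index pairs that are
    not listed.\<close>
  define Q :: "real \<Rightarrow> real \<Rightarrow> real \<Rightarrow> real \<Rightarrow> real \<Rightarrow> nat \<Rightarrow> nat \<Rightarrow> real" where
    "Q u v w x y = (\<lambda>i j. if (i, j) = (0, 1) then u else if (i, j) = (0, 2) then v
      else if (i, j) = (0, 3) then w else if (i, j) = (1, 2) then x
      else if (i, j) = (1, 3) then y else 0)" for u v w x y
  have s: "s = 1 - c" using cs by simp
  have "c \<le> 1" using cs by simp
  then have "c * b \<le> b" "c * (1 - b) \<le> 1 - b" using b cs by (intro mult_left_le_one_le; simp)+
  note assms = assms this
  show ?thesis
  proof (cases "b \<le> 1 / 2")
    case True
    \<comment> \<open>Vertex 3 is the smallest and 0 the largest; the weight on {1, 2} is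
      nonnegative by \<open>c * (1 - b) \<le> 1 / 2\<close>.\<close>
    then show ?thesis using assms
      by (intro exI[of _ "Q ((c - s) / 2) ((1 - 2 * b) / 2) (s * b) ((1 - 2 * c * (1 - b)) / 2) 0"])
        (auto simp: Q_def s field_simps)
  next
    case False
    \<comment> \<open>Vertex 2 is the smallest and 1 the largest; the weight on {0, 3} is
      nonnegative by \<open>c * b \<le> 1 / 2\<close>.\<close>
    then show ?thesis using assms
      by (intro exI[of _ "Q ((c - s) / 2) 0 ((1 - 2 * c * b) / 2) (s * (1 - b)) ((2 * b - 1) / 2)"])
        (auto simp: Q_def s field_simps)
  qed
qed

theorem proposition5:
  fixes \<theta> \<alpha> \<beta> \<gamma> :: real
  assumes "0 < \<theta>" and "\<theta> \<le> pi / 4"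
    and "\<alpha> > 0" and "\<beta> > 0" and "\<gamma> > 0"
    and "\<alpha>\<^sup>2 + \<beta>\<^sup>2 + \<gamma>\<^sup>2 = 1"
  shows "transfer_restorable \<theta> \<alpha> \<beta> \<gamma> \<longleftrightarrow>
    (1 - (tan \<theta>)\<^sup>2) / 2 \<le> \<beta>\<^sup>2 \<and> \<beta>\<^sup>2 \<le> (1 + (tan \<theta>)\<^sup>2) / 2"
proof -
  let ?c = "(cos \<theta>)\<^sup>2" and ?s = "(sin \<theta>)\<^sup>2"
  have \<theta>: "\<theta> < pi / 2" using assms by simp
  have cpos: "0 < cos \<theta>" using assms \<theta> by (intro cos_gt_zero) auto
  have spos: "0 < sin \<theta>" using assms by (intro sin_gt_zero) auto
  \<comment> \<open>This is where \<theta> \<le> pi / 4 enters: the largest Schmidt coefficient is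
    one of the two containing the cosine.\<close>
  have sc: "?s \<le> ?c"
  proof -
    have "0 \<le> cos (2 * \<theta>)" using assms by (intro cos_ge_zero) auto
    then show ?thesis by (simp add: cos_double)
  qed
  have \<beta>1: "\<alpha>\<^sup>2 + \<gamma>\<^sup>2 = 1 - \<beta>\<^sup>2" using assms by simp
  have tan: "(tan \<theta>)\<^sup>2 = ?s / ?c" by (simp add: tan_def power_divide)
  \<comment> \<open>With c the squared cosine, the squared tangent is (1 - c) / c, so the ends of
    the interval are 1 - 1 / (2 c) and 1 / (2 c).\<close>
  have bounds: "(1 - (tan \<theta>)\<^sup>2) / 2 \<le> \<beta>\<^sup>2 \<and> \<beta>\<^sup>2 \<le> (1 + (tan \<theta>)\<^sup>2) / 2
      \<longleftrightarrow> ?c * \<beta>\<^sup>2 \<le> 1 / 2 \<and> ?c * (1 - \<beta>\<^sup>2) \<le> 1 / 2"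
  proof -
    have "(1 - (1 - c) / c) / 2 \<le> b \<and> b \<le> (1 + (1 - c) / c) / 2
        \<longleftrightarrow> c * b \<le> 1 / 2 \<and> c * (1 - b) \<le> 1 / 2" if "0 < c" for b c :: real
      using that by (auto simp: field_simps)
    from this[of ?c] cpos show ?thesis unfolding tan sin_squared_eq by simp
  qed
  show ?thesis
    unfolding bounds
  proof
    assume "transfer_restorable \<theta> \<alpha> \<beta> \<gamma>"
    then obtain P where "locc 8 4 P" "restores_Bell_pair P 8 4 (ens (8 * 4) [W_matrix \<theta> \<alpha> \<beta> \<gamma>])"
      unfolding transfer_restorable_def proj_on_transfer_state by blast
    then have "schmidt_le_half (W_matrix \<theta> \<alpha> \<beta> \<gamma>)"
      using W_matrix_carrier by (intro restores_imp_schmidt_le_half) auto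
    \<comment> \<open>Columns 0 and 1 carry the two coefficients with the cosine.\<close>
    from schmidt_le_half_col[OF this W_matrix_carrier, of 0] schmidt_le_half_col[OF this W_matrix_carrier, of 1]
    show "?c * \<beta>\<^sup>2 \<le> 1 / 2 \<and> ?c * (1 - \<beta>\<^sup>2) \<le> 1 / 2"
      using assms unfolding sqnorm_col_W_matrix \<beta>1 by (simp add: frob_W_matrix)
  next
    assume c: "?c * \<beta>\<^sup>2 \<le> 1 / 2 \<and> ?c * (1 - \<beta>\<^sup>2) \<le> 1 / 2"
    define \<nu> where "\<nu> = sqrt (\<alpha>\<^sup>2 + \<gamma>\<^sup>2)"
    have pos: "0 < \<alpha>\<^sup>2 + \<gamma>\<^sup>2" using assms by (intro add_pos_pos) auto
    then have \<nu>: "0 < \<nu>" "\<alpha>\<^sup>2 + \<gamma>\<^sup>2 = \<nu>\<^sup>2" by (auto simp: \<nu>_def)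
    have "0 \<le> \<beta>\<^sup>2" "\<beta>\<^sup>2 \<le> 1" using \<beta>1 pos by auto
    with pair_weights_exist[of ?c ?s "\<beta>\<^sup>2"] c sc
    obtain q where q: "\<And>i j. 0 \<le> q i j"
      "?c * (1 - \<beta>\<^sup>2) = q 0 1 + q 0 2 + q (0::nat) (3::nat)" "?c * \<beta>\<^sup>2 = q 0 1 + q 1 2 + q 1 3"
      "?s * (1 - \<beta>\<^sup>2) = q 0 2 + q 1 2 + q 2 3" "?s * \<beta>\<^sup>2 = q 0 3 + q 1 3 + q 2 3"
      by auto
    have "\<exists>P. locc 4 4 P \<and> restores_Bell_pair P 4 4 (ens (4 * 4) [diag4 (schmidt \<theta> \<beta> \<nu>), 0\<^sub>m 4 4])"
    proof (rule diag4_restorable[OF _ q(1)])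
      show "0 < schmidt \<theta> \<beta> \<nu> k" for k using cpos spos \<nu> assms by (simp add: schmidt_def)
    qed (simp_all add: schmidt_def power_mult_distrib \<nu>(2)[symmetric] \<beta>1 q(2-))
    then show "transfer_restorable \<theta> \<alpha> \<beta> \<gamma>"
      using transfer_restorable_if_diag4 \<nu> by (metis less_irrefl)
  qed
qed

end
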